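(* Let $m\ge 2$ be an integer, let $w$ be an infinite periodic or Sturmian word over $\{0,1\}$ with slope $\alpha=\pi(w)$, and let $A=A(m,w)=A_0\oplus A_1$ carry the $\mathbb{Z}_2$-grading in which $a,z_1^{(1)}\in A_0$ and $b\in A_1$. Then the graded PI-exponent $\exp^{gr}(A)$ exists and $$\exp^{gr}(A)=\exp(A)=\Phi\Big(\frac{1}{m+\alpha}\Big).$$
   Context: $F$ is a field of characteristic zero; algebras are nonassociative. For integers $k_i\ge 2$, $A(K)$ is the algebra with basis $\{a,b,z_j^{(i)}: i\ge1, 1\le j\le k_i\}$ and multiplication $z_j^{(i)}a=z_{j+1}^{(i)}$ ($1\le j<k_i$), $z_{k_i}^{(i)}b=z_1^{(i+1)}$, all other products of basis elements zero. For an integer $m\ge2$ and an infinite word $w=w_1w_2\cdots$ over $\{0,1\}$, $A(m,w)$ is $A(K)$ with $k_i=m+w_i$. It is generated by $z_1^{(1)},a,b$. The grading with $z_1^{(1)},a$ even and $b$ odd is: $A_0=\mathrm{span}\{a, z_j^{(i)}: i \text{ odd}\}$, $A_1=\mathrm{span}\{b,z_j^{(i)}: i\text{ even}\}$. The complexity $\mathrm{Comp}_w(n)$ is the number of distinct length-$n$ subwords of $w$; $w$ is Sturmian if $\mathrm{Comp}_w(n)=n+1$ for all $n\ge1$. The slope is $\pi(w)=\lim_{n\to\infty}(w_1+\dots+w_n)/n$ (it exists for periodic and Sturmian words). $\Phi(x)=x^{-x}(1-x)^{-(1-x)}$ for $0\le x\le1$. Ordinary codimensions: $c_n(A)=\dim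 P_n/(P_n\cap Id(A))$ with $P_n$ the multilinear polynomials of degree $n$ in the free nonassociative algebra, $\exp(A)=\lim\sqrt[n]{c_n(A)}$. Graded codimensions: in the free algebra $F\{X,Y\}$ with even generators $X$ and odd generators $Y$, a polynomial is a graded identity if it vanishes whenever even variables are replaced by elements of $A_0$ and odd by elements of $A_1$; $Id^{gr}(A)$ is the ideal of graded identities; $P_{k,n-k}$ is the space of polynomials multilinear in $x_1,\dots,x_k\in X$, $y_1,\dots,y_{n-k}\in Y$; $c_{k,n-k}(A)=\dim P_{k,n-k}/(P_{k,n-k}\cap Id^{gr}(A))$; $c_n^{gr}(A)=\sum_{k=0}^n\binom nk c_{k,n-k}(A)$; $\exp^{gr}(A)=\lim_{n\to\infty}\sqrt[n]{c_n^{gr}(A)}$ when the limit exists, with $\underline{\exp}^{gr},\overline{\exp}^{gr}$ the liminf and limsup. *)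

theory Defs
  imports Complex_Main "HOL-Library.Function_Algebras"
begin

text \<open>Nonassociative monomials = binary bracketings with leaves labelled by variables.\<close>
datatype 'v mtree = Leaf 'v | Node "'v mtree" "'v mtree"

fun leaves :: "'v mtree \<Rightarrow> 'v list" where
  "leaves (Leaf v) = [v]"
| "leaves (Node l r) = leaves l @ leaves r"

definition mono_set :: "'v set \<Rightarrow> 'v mtree set" where
  "mono_set V = {t. distinct (leaves t) \<and> set (leaves t) = V}"

definition multilin_polys :: "'v set \<Rightarrow> ('v mtree \<Rightarrow> 'a::field) set" where
  "multilin_polys V = {f. \<forall>t. f t \<noteq> 0 \<longrightarrow> t \<in> mono_set V}"

definition poly_scale :: "'a::field \<Rightarrow> ('v mtree \<Rightarrow> 'a) \<Rightarrow> ('v mtree \<Rightarrow> 'a)" where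
  "poly_scale c f = (\<lambda>t. c * f t)"

text \<open>Algebra elements are functions 'b => 'a (coordinates w.r.t. a basis indexed by 'b);
  mul is the algebra multiplication.\<close>
fun mon_eval :: "('e \<Rightarrow> 'e \<Rightarrow> 'e) \<Rightarrow> ('v \<Rightarrow> 'e) \<Rightarrow> 'v mtree \<Rightarrow> 'e" where
  "mon_eval mul \<sigma> (Leaf v) = \<sigma> v"
| "mon_eval mul \<sigma> (Node l r) = mul (mon_eval mul \<sigma> l) (mon_eval mul \<sigma> r)"

definition poly_eval ::
  "(('b \<Rightarrow> 'a) \<Rightarrow> ('b \<Rightarrow> 'a) \<Rightarrow> ('b \<Rightarrow> 'a)) \<Rightarrow> ('v \<Rightarrow> ('b \<Rightarrow> 'a)) \<Rightarrow> 'v set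
     \<Rightarrow> ('v mtree \<Rightarrow> 'a::field) \<Rightarrow> ('b \<Rightarrow> 'a)" where
  "poly_eval mul \<sigma> V f = (\<lambda>g. \<Sum>t\<in>mono_set V. f t * mon_eval mul \<sigma> t g)"

definition ident_part ::
  "(('b \<Rightarrow> 'a) \<Rightarrow> ('b \<Rightarrow> 'a) \<Rightarrow> ('b \<Rightarrow> 'a)) \<Rightarrow> ('v \<Rightarrow> ('b \<Rightarrow> 'a)) set \<Rightarrow> 'v set
     \<Rightarrow> ('v mtree \<Rightarrow> 'a::field) set" where
  "ident_part mul S V =
     {f \<in> multilin_polys V. \<forall>\<sigma>\<in>S. poly_eval mul \<sigma> V f = (\<lambda>_. 0)}"

text \<open>dim (P_V / (P_V \<inter> Id)) = dim P_V - dim (P_V \<inter> Id).\<close>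
definition codim ::
  "(('b \<Rightarrow> 'a) \<Rightarrow> ('b \<Rightarrow> 'a) \<Rightarrow> ('b \<Rightarrow> 'a)) \<Rightarrow> ('v \<Rightarrow> ('b \<Rightarrow> 'a)) set \<Rightarrow> 'v set
     \<Rightarrow> ('v mtree \<Rightarrow> 'a::field) itself \<Rightarrow> nat" where
  "codim mul S V _ =
     vector_space.dim poly_scale (multilin_polys V :: ('v mtree \<Rightarrow> 'a) set)
     - vector_space.dim poly_scale (ident_part mul S V)"

text \<open>Basis of A(K): a, b and z_j^(i) (= GZ i j) for i \<ge> 1, 1 \<le> j \<le> k_i.\<close>
datatype gen = GA | GB | GZ nat nat

definition basis_set :: "(nat \<Rightarrow> nat) \<Rightarrow> gen set" where
  "basis_set k = {GA, GB} \<union> {GZ i j | i j. 1 \<le> i \<and> 1 \<le> j \<and> j \<le> k i}"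

fun mulb :: "(nat \<Rightarrow> nat) \<Rightarrow> gen \<Rightarrow> gen \<Rightarrow> gen option" where
  "mulb k (GZ i j) GA = (if j < k i then Some (GZ i (Suc j)) else None)"
| "mulb k (GZ i j) GB = (if j = k i then Some (GZ (Suc i) 1) else None)"
| "mulb k _ _ = None"

definition supp :: "(gen \<Rightarrow> 'a::zero) \<Rightarrow> gen set" where
  "supp u = {e. u e \<noteq> 0}"

definition alg_carrier :: "(nat \<Rightarrow> nat) \<Rightarrow> (gen \<Rightarrow> 'a::field) set" where
  "alg_carrier k = {u. finite (supp u) \<and> supp u \<subseteq> basis_set k}"

definition alg_mul :: "(nat \<Rightarrow> nat) \<Rightarrow> (gen \<Rightarrow> 'a::field) \<Rightarrow> (gen \<Rightarrow> 'a) \<Rightarrow> (gen \<Rightarrow> 'a)" where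
  "alg_mul k u v = (\<lambda>g. \<Sum>e\<in>supp u. \<Sum>e'\<in>supp v.
       (if mulb k e e' = Some g then u e * v e' else 0))"

text \<open>A(m,w): k_i = m + w_i.  The infinite word w_1 w_2 ... is the function w with
  w_i = w (i - 1), i.e. w is indexed from 0.\<close>
definition kmw :: "nat \<Rightarrow> (nat \<Rightarrow> nat) \<Rightarrow> nat \<Rightarrow> nat" where
  "kmw m w i = m + w (i - 1)"

definition alg_even :: "(nat \<Rightarrow> nat) \<Rightarrow> (gen \<Rightarrow> 'a::field) set" where
  "alg_even k = {u \<in> alg_carrier k. supp u \<subseteq> {GA} \<union> {GZ i j | i j. odd i}}"

definition alg_odd :: "(nat \<Rightarrow> nat) \<Rightarrow> (gen \<Rightarrow> 'a::field) set" where
  "alg_odd k = {u \<in> alg_carrier k. supp u \<subseteq> {GB} \<union> {GZ i j | i j. even i}}"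

definition cn :: "'a::field itself \<Rightarrow> nat \<Rightarrow> (nat \<Rightarrow> nat) \<Rightarrow> nat \<Rightarrow> nat" where
  "cn _ m w n = codim (alg_mul (kmw m w))
      {\<sigma>. \<forall>v. \<sigma> v \<in> (alg_carrier (kmw m w) :: (gen \<Rightarrow> 'a) set)} {..<n}
      (TYPE(nat mtree \<Rightarrow> 'a))"

definition ckn :: "'a::field itself \<Rightarrow> nat \<Rightarrow> (nat \<Rightarrow> nat) \<Rightarrow> nat \<Rightarrow> nat \<Rightarrow> nat" where
  "ckn _ m w k n = codim (alg_mul (kmw m w))
      {\<sigma>. \<forall>i. \<sigma> (Inl i) \<in> (alg_even (kmw m w) :: (gen \<Rightarrow> 'a) set)
              \<and> \<sigma> (Inr i) \<in> (alg_odd (kmw m w) :: (gen \<Rightarrow> 'a) set)}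
      (Inl ` {..<k} \<union> Inr ` {..<n - k})
      (TYPE((nat + nat) mtree \<Rightarrow> 'a))"

definition cn_gr :: "'a::field itself \<Rightarrow> nat \<Rightarrow> (nat \<Rightarrow> nat) \<Rightarrow> nat \<Rightarrow> nat" where
  "cn_gr T m w n = (\<Sum>k\<le>n. (n choose k) * ckn T m w k n)"

definition subwords :: "(nat \<Rightarrow> nat) \<Rightarrow> nat \<Rightarrow> nat list set" where
  "subwords w n = {map (\<lambda>t. w (s + t)) [0..<n] | s. True}"

definition complexity :: "(nat \<Rightarrow> nat) \<Rightarrow> nat \<Rightarrow> nat" where
  "complexity w n = card (subwords w n)"

definition binary_word :: "(nat \<Rightarrow> nat) \<Rightarrow> bool" where
  "binary_word w \<longleftrightarrow> (\<forall>i. w i \<in> {0, 1})"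

definition periodic_word :: "(nat \<Rightarrow> nat) \<Rightarrow> bool" where
  "periodic_word w \<longleftrightarrow> (\<exists>p>0. \<forall>i. w (i + p) = w i)"

definition sturmian :: "(nat \<Rightarrow> nat) \<Rightarrow> bool" where
  "sturmian w \<longleftrightarrow> (\<forall>n\<ge>1. complexity w n = n + 1)"

definition has_slope :: "(nat \<Rightarrow> nat) \<Rightarrow> real \<Rightarrow> bool" where
  "has_slope w \<alpha> \<longleftrightarrow> ((\<lambda>n. real (\<Sum>i<n. w i) / real n) \<longlonglongrightarrow> \<alpha>)"

definition Phi :: "real \<Rightarrow> real" where
  "Phi x = (if x = 0 \<or> x = 1 then 1 else x powr (- x) * (1 - x) powr (- (1 - x)))"

end

theory Submission
  imports Defs "HOL-Real_Asymp.Real_Asymp"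
begin

text \<open>The basis vectors \<open>z\<close> form a single line \<open>z\<^sub>0, z\<^sub>1, \<dots>\<close> along which exactly one of \<open>a\<close> and
  \<open>b\<close> moves one step forward, so the algebra is an infinite word over \<open>{a, b}\<close> and only left-normed
  monomials survive. The value of a multilinear polynomial starting at \<open>z\<^sub>p\<close> is governed by the
  coefficient sums over monomials with a prescribed first variable and a prescribed set of variables in
  the \<open>b\<close>-positions of the factor at \<open>p\<close>. Hence both codimensions are, up to a polynomial
  factor (there are only linearly many factors of each length), binomial coefficients \<open>n choose d\<close> with \<open>d\<close> the number of \<open>b\<close>'s in
  a factor. Since \<open>w\<close> is balanced, \<open>d\<close> stays within a constant of \<open>n / (m + \<alpha>)\<close>.\<close>

section \<open>Balanced words\<close>

text \<open>Why the two exponents agree: a left-normed monomial is seen only through the pair (v,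
  S), with v its first variable and S the set of variables standing at letters b. Without grading
  every set S of the right size d can be detected, which gives (n - 1) choose d classes for each v
  and each factor. With grading an even variable has no b-coordinate and an odd one has no
  a-coordinate, so S must be the set of odd variables other than v. Each c_{k,n-k} is then only
  polynomially large, and it is 0 unless n - k is close to n / (m + \<alpha>). The lost binomial
  coefficient returns as the weight n choose k in the definition of the graded codimension.

  The first variable may itself be odd, so d and the number of odd variables can differ by one;
  since it uses up one variable, the lower bounds have n - 1 where the upper bounds have n. These
  shifts and the bounded error from balance disappear in n-th roots: the logarithm of n choose d is
  n times the entropy of d / n up to O(log n), the entropy is continuous, and \<open>Phi\<close> is
  its exponential.\<close>

definition wsum :: "(nat \<Rightarrow> nat) \<Rightarrow> nat \<Rightarrow> nat \<Rightarrow> nat" where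
  "wsum w i n = (\<Sum>t<n. w (i + t))"

definition factor_at :: "(nat \<Rightarrow> nat) \<Rightarrow> nat \<Rightarrow> nat \<Rightarrow> nat list" where
  "factor_at w n s = map (\<lambda>t. w (s + t)) [0..<n]"

definition right_special :: "(nat \<Rightarrow> nat) \<Rightarrow> nat \<Rightarrow> nat list set" where
  "right_special w n = {x. x @ [0] \<in> subwords w (Suc n) \<and> x @ [1] \<in> subwords w (Suc n)}"

lemma wsum_0 [simp]: "wsum w i 0 = 0"
  by (simp add: wsum_def)

lemma wsum_Suc: "wsum w i (Suc n) = wsum w i n + w (i + n)"
  by (simp add: wsum_def)

lemma wsum_add: "wsum w i (a + b) = wsum w i a + wsum w (i + a) b"
  by (induction b) (simp_all add: wsum_Suc add.assoc)

lemma wsum_Suc_left: "wsum w i (Suc n) = w i + wsum w (Suc i) n"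
  using wsum_add[of w i 1 n] by (simp add: wsum_def)

lemma wsum_le: "binary_word w \<Longrightarrow> wsum w i n \<le> n"
proof (induction n)
  case (Suc n)
  then have "w (i + n) \<le> 1" unfolding binary_word_def by (metis insertE le_refl singletonD zero_le)
  with Suc show ?case by (simp add: wsum_Suc)
qed simp

section \<open>Factors, right special factors and complexity\<close>

lemma subwords_eq: "subwords w n = range (factor_at w n)"
  by (auto simp: subwords_def factor_at_def)

lemma factor_at_in: "factor_at w n s \<in> subwords w n"
  by (simp add: subwords_eq)

lemma length_factor_at [simp]: "length (factor_at w n s) = n"
  by (simp add: factor_at_def)

lemma factor_at_eq_iff: "factor_at w n s = factor_at w n s' \<longleftrightarrow> (\<forall>t<n. w (s + t) = w (s' + t))"
  by (auto simp: factor_at_def)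

lemma factor_at_Suc: "factor_at w (Suc n) s = factor_at w n s @ [w (s + n)]"
  by (simp add: factor_at_def)

lemma binary_cases: "binary_word w \<Longrightarrow> w i = 0 \<or> w i = 1"
  by (auto simp: binary_word_def)

lemma finite_subwords:
  assumes "binary_word w"
  shows "finite (subwords w n)"
proof (rule finite_subset)
  show "subwords w n \<subseteq> {xs. set xs \<subseteq> {0, 1} \<and> length xs = n}"
  proof
    fix x assume "x \<in> subwords w n"
    then obtain s where "x = factor_at w n s" by (auto simp: subwords_eq)
    moreover have "w (s + t) \<in> {0, 1}" for t using binary_cases[OF assms, of "s + t"] by simp
    ultimately show "x \<in> {xs. set xs \<subseteq> {0, 1} \<and> length xs = n}"
      by (simp only: mem_Collect_eq factor_at_def set_map length_map length_upt diff_zero image_subset_iff) blast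
  qed
  show "finite {xs. set xs \<subseteq> {0, 1::nat} \<and> length xs = n}"
    by (rule finite_lists_length_eq) simp
qed

text \<open>Deleting the last letter maps the factors of length n + 1 onto those of length n,
  because every occurrence can be prolonged to the right. The fibre has two elements exactly over
  the right special factors.\<close>

lemma card_subwords_Suc:
  assumes w: "binary_word w"
  shows "complexity w (Suc n) = complexity w n + card (right_special w n)"
proof -
  let ?P = "\<lambda>c. {x. x @ [c] \<in> subwords w (Suc n)}"
  have fin: "finite (?P c)" for c
  proof -
    have "(\<lambda>x. x @ [c]) ` ?P c \<subseteq> subwords w (Suc n)" by auto
    then have "finite ((\<lambda>x. x @ [c]) ` ?P c)" using finite_subwords[OF w] finite_subset by blast
    then show ?thesis by (rule finite_imageD) (simp add: inj_on_def)
  qed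
  have U: "?P 0 \<union> ?P 1 = subwords w n"
  proof
    show "?P 0 \<union> ?P 1 \<subseteq> subwords w n"
      by (auto simp: subwords_eq factor_at_Suc)
    show "subwords w n \<subseteq> ?P 0 \<union> ?P 1"
    proof
      fix x assume "x \<in> subwords w n"
      then obtain s where "x = factor_at w n s" by (auto simp: subwords_eq)
      then have "x @ [w (s + n)] \<in> subwords w (Suc n)"
        by (metis factor_at_Suc factor_at_in)
      then show "x \<in> ?P 0 \<union> ?P 1" using binary_cases[OF w, of "s + n"] by auto
    qed
  qed
  have "subwords w (Suc n) = (\<lambda>x. x @ [0]) ` ?P 0 \<union> (\<lambda>x. x @ [1]) ` ?P 1"
  proof
    show "subwords w (Suc n) \<subseteq> (\<lambda>x. x @ [0]) ` ?P 0 \<union> (\<lambda>x. x @ [1]) ` ?P 1"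
    proof
      fix y assume y: "y \<in> subwords w (Suc n)"
      then obtain s where "y = factor_at w n s @ [w (s + n)]" by (auto simp: subwords_eq factor_at_Suc)
      then show "y \<in> (\<lambda>x. x @ [0]) ` ?P 0 \<union> (\<lambda>x. x @ [1]) ` ?P 1"
        using binary_cases[OF w, of "s + n"] y by auto
    qed
  qed auto
  then have "complexity w (Suc n) = card ((\<lambda>x. x @ [0]) ` ?P 0) + card ((\<lambda>x. x @ [1]) ` ?P 1)"
    unfolding complexity_def using fin by (subst card_Un_disjoint[symmetric]) auto
  also have "\<dots> = card (?P 0) + card (?P 1)"
    by (simp add: card_image inj_on_def)
  also have "\<dots> = card (?P 0 \<union> ?P 1) + card (?P 0 \<inter> ?P 1)"
    by (rule card_Un_Int[OF fin fin])
  also have "?P 0 \<inter> ?P 1 = right_special w n"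
    by (auto simp: right_special_def)
  finally show ?thesis using U by (simp add: complexity_def)
qed

lemma complexity_0: "complexity w 0 = 1"
  by (simp add: complexity_def subwords_eq factor_at_def)

lemma sturmian_complexity: "sturmian w \<Longrightarrow> complexity w n = n + 1"
  by (cases "n = 0") (auto simp: sturmian_def complexity_0)

lemma sturmian_unique_right_special:
  assumes "binary_word w" "sturmian w"
  obtains r where "right_special w n = {r}"
proof -
  have "card (right_special w n) = 1"
    using card_subwords_Suc[OF assms(1), of n] by (simp add: sturmian_complexity[OF assms(2)])
  then show ?thesis using that card_1_singletonE by blast
qed

lemma right_specialI:
  assumes "factor_at w n s = factor_at w n s'" "w (s + n) = 0" "w (s' + n) = 1"
  shows "factor_at w n s \<in> right_special w n"
  unfolding right_special_def using assms factor_at_in[of w "Suc n" s] factor_at_in[of w "Suc n" s']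
  by (simp add: factor_at_Suc)

lemma factor_at_next:
  assumes "binary_word w" "factor_at w n x = factor_at w n y" "factor_at w n x \<notin> right_special w n"
  shows "factor_at w (Suc n) x = factor_at w (Suc n) y"
  using assms right_specialI[of w n x y] right_specialI[of w n y x]
    binary_cases[OF assms(1), of "x + n"] binary_cases[OF assms(1), of "y + n"]
  by (auto simp: factor_at_Suc)

text \<open>A starting position at or beyond s + p can be moved back by p without changing the
  factor, so only the first s + p positions count. For s = 0 this bounds the complexity of a
  periodic word; for general s it shows that a Sturmian word is not eventually periodic.\<close>

lemma eventually_periodic_complexity:
  assumes "p > 0" "\<And>t. t \<ge> s \<Longrightarrow> w (t + p) = w t"
  shows "complexity w n \<le> s + p"
proof -
  have "factor_at w n x \<in> factor_at w n ` {..<s + p}" for x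
  proof (induction x rule: less_induct)
    case (less x)
    show ?case
    proof (cases "x < s + p")
      case False
      have "factor_at w n x = factor_at w n (x - p)"
      proof (unfold factor_at_eq_iff, intro allI impI)
        fix t assume "t < n"
        have "w ((x - p + t) + p) = w (x - p + t)" using False by (intro assms(2)) auto
        then show "w (x + t) = w (x - p + t)" using False by (simp add: add.commute add.left_commute)
      qed
      moreover have "x - p < x" using False assms(1) by auto
      ultimately show ?thesis using less by metis
    qed auto
  qed
  then have "subwords w n \<subseteq> factor_at w n ` {..<s + p}" by (auto simp: subwords_eq)
  then have "card (subwords w n) \<le> card (factor_at w n ` {..<s + p})" by (intro card_mono) auto
  also have "\<dots> \<le> s + p" using card_image_le[of "{..<s + p}"] by simp
  finally show ?thesis by (simp add: complexity_def)
qed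

text \<open>Otherwise the \<open>n + 1\<close> factors starting at \<open>s, \<dots>, s + n\<close> take at most \<open>n\<close> values, so two of them agree;
  as their continuations are forced, the word is eventually periodic.\<close>
lemma sturmian_meets_right_special:
  assumes w: "binary_word w" and st: "sturmian w" and n: "n > 0"
  shows "\<exists>q\<le>n. factor_at w n (s + q) \<in> right_special w n"
proof (rule ccontr)
  assume *: "\<not> ?thesis"
  let ?f = "factor_at w n"
  obtain r where r: "right_special w n = {r}" using sturmian_unique_right_special[OF w st] .
  have rin: "r \<in> subwords w n"
    using r by (auto simp: right_special_def subwords_eq factor_at_Suc)
  have "?f ` {s..s + n} \<subseteq> subwords w n - {r}"
  proof
    fix x assume "x \<in> ?f ` {s..s + n}"
    then obtain y where y: "y \<in> {s..s + n}" "x = ?f y" by blast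
    then obtain q where "y = s + q" "q \<le> n"
      by (metis add_le_cancel_left atLeastAtMost_iff nat_le_iff_add)
    with * r y show "x \<in> subwords w n - {r}" by (auto simp: factor_at_in)
  qed
  then have "card (?f ` {s..s + n}) \<le> card (subwords w n - {r})"
    by (intro card_mono) (auto simp: finite_subwords[OF w])
  also have "\<dots> = n"
    using rin sturmian_complexity[OF st, of n] finite_subwords[OF w, of n]
    by (simp add: complexity_def)
  finally have "\<not> inj_on ?f {s..s + n}"
    using pigeonhole[of ?f "{s..s + n}"] by simp
  then obtain a b where ab: "s \<le> a" "a < b" "b \<le> s + n" "?f a = ?f b"
    unfolding inj_on_def by (metis atLeastAtMost_iff nat_neq_iff)
  define p where "p = b - a"
  have nsp: "?f x \<notin> right_special w n" if "a \<le> x" "x \<le> b" for x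
  proof -
    have "x - s \<le> n" using that ab by auto
    with * have "?f (s + (x - s)) \<notin> right_special w n" by blast
    then show ?thesis using that ab by simp
  qed
  \<comment> \<open>Invariant of the walk from a: the current factor occurs among those at positions
    a, ..., b - 1, none of which is right special, so its next letter is forced. The list closes up
    at b because the factors at a and b coincide.\<close>
  have *: "(\<exists>x. a \<le> x \<and> x < b \<and> ?f (a + t) = ?f x) \<and> ?f (a + t + p) = ?f (a + t)" for t
  proof (induction t)
    case 0
    show ?case using ab p_def by auto
  next
    case (Suc t)
    then obtain x where x: "a \<le> x" "x < b" "?f (a + t) = ?f x" by blast
    have nx: "?f (Suc y) = ?f (Suc z)" if "?f y = ?f x" "?f z = ?f x" for y z
    proof -
      have "factor_at w (Suc n) y = factor_at w (Suc n) z"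
        by (rule factor_at_next[OF w]) (use that nsp[of x] x in auto)
      then have "\<forall>t<Suc n. w (y + t) = w (z + t)" by (simp only: factor_at_eq_iff)
      then have "\<forall>t<n. w (y + Suc t) = w (z + Suc t)" by blast
      then show ?thesis by (simp add: factor_at_eq_iff)
    qed
    have "?f (Suc (a + t)) = ?f (Suc x)" using x by (intro nx) auto
    moreover have "?f (Suc (a + t + p)) = ?f (Suc (a + t))" using x Suc by (intro nx) auto
    moreover have "\<exists>y. a \<le> y \<and> y < b \<and> ?f (Suc x) = ?f y"
    proof (cases "Suc x = b")
      case True
      then show ?thesis using ab by auto
    next
      case False
      then show ?thesis using x by (intro exI[of _ "Suc x"]) auto
    qed
    ultimately show ?case by auto
  qed
  have "w (t + p) = w t" if "t \<ge> a" for t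
    using *[of "t - a"] that n by (auto simp: factor_at_eq_iff)
  \<comment> \<open>The length a + p is chosen because a Sturmian word has a + p + 1 factors of that
    length.\<close>
  then have "complexity w (a + p) \<le> a + p"
    using eventually_periodic_complexity[of p a w] ab p_def by auto
  then show False by (simp add: sturmian_complexity[OF st])
qed

text \<open>A shortest unbalanced pair of factors has the form \<open>0v0\<close>, \<open>1v1\<close> with \<open>v\<close> a palindrome. The right
  special factor of length \<open>|v| + 1\<close> is \<open>0v\<close> or \<open>1v\<close>, and it cannot start in the stretch of length
  \<open>|v| + 2\<close> that begins with the other one.\<close>
lemma sturmian_balanced:
  assumes w: "binary_word w" and st: "sturmian w"
  shows "wsum w i n \<le> wsum w j n + 1"
proof (rule ccontr)
  assume "\<not> ?thesis"
  then have ex: "\<exists>n i j. wsum w j n + 2 \<le> wsum w i n"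
    by (intro exI[of _ n] exI[of _ i] exI[of _ j]) simp
  define n where "n = (LEAST n. \<exists>i j. wsum w j n + 2 \<le> wsum w i n)"
  obtain i j where ij: "wsum w j n + 2 \<le> wsum w i n"
    using LeastI_ex[OF ex] unfolding n_def by blast
  have min: "wsum w i' k \<le> wsum w j' k + 1" if "k < n" for k i' j'
    using not_less_Least[of k "\<lambda>n. \<exists>i j. wsum w j n + 2 \<le> wsum w i n"] that
    unfolding n_def[symmetric] by (metis add_2_eq_Suc' add.commute not_less_eq_eq plus_1_eq_Suc)
  have le1: "w k \<le> 1" for k using binary_cases[OF w, of k] by auto
  have n2: "n \<ge> 2" using ij wsum_le[OF w, of i n] by auto
  \<comment> \<open>Prefix and remaining suffix are both shorter than the minimal n, so each
    contributes a surplus of at most 1, while the total surplus is at least 2. Hence every proper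
    nonempty prefix has surplus exactly 1, which fixes the first letters (1 and 0), makes the middle
    letters agree, and fixes the last letters (1 and 0).\<close>
  have eq1: "wsum w i k = wsum w j k + 1" if "1 \<le> k" "k < n" for k
  proof -
    have "wsum w i k \<le> wsum w j k + 1" using min that by auto
    moreover have "wsum w (i + k) (n - k) \<le> wsum w (j + k) (n - k) + 1" using min that by auto
    moreover have "wsum w i n = wsum w i k + wsum w (i + k) (n - k)"
      using wsum_add[of w i k "n - k"] that by simp
    moreover have "wsum w j n = wsum w j k + wsum w (j + k) (n - k)"
      using wsum_add[of w j k "n - k"] that by simp
    ultimately show ?thesis using ij by linarith
  qed
  obtain N where N: "n = Suc N" "N > 0" using n2 by (cases n) auto
  have first: "w i = 1" "w j = 0"
    using eq1[of 1] le1[of i] le1[of j] n2 by (auto simp: wsum_def)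
  have mid: "w (i + k) = w (j + k)" if "1 \<le> k" "k < N" for k
    using eq1[of k] eq1[of "Suc k"] that N by (simp add: wsum_Suc)
  have last: "w (i + N) = 1" "w (j + N) = 0"
    using ij eq1[of N] N le1[of "i + N"] le1[of "j + N"] by (auto simp: wsum_Suc)
  \<comment> \<open>The last k + 1 letters, summed from the right end, so that they can be compared
    term by term with the first k + 1.\<close>
  have reflect: "wsum w (a + (N - k)) (Suc k) = w (a + (N - k)) + (\<Sum>t\<in>{1..<k}. w (a + (N - t))) + w (a + N)"
    if "1 \<le> k" "k < N" for a k
  proof -
    have "wsum w (a + (N - k)) (Suc k) = (\<Sum>t\<in>{0..k}. w (a + (N - k) + t))"
      unfolding wsum_def by (simp add: atLeast0AtMost lessThan_Suc_atMost)
    also have "\<dots> = (\<Sum>t\<in>{0..k}. w (a + (N - t)))"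
    proof (rule sum.reindex_bij_witness[of _ "\<lambda>t. k - t" "\<lambda>t. k - t"])
      fix t assume "t \<in> {0..k}"
      then have "a + (N - (k - t)) = a + (N - k) + t" using that by auto
      then show "w (a + (N - (k - t))) = w (a + (N - k) + t)" by (rule arg_cong)
    qed auto
    also have "{0..k} = insert 0 (insert k {1..<k})" using that by auto
    finally show ?thesis using that by simp
  qed
  have direct: "wsum w a (Suc k) = w a + (\<Sum>t\<in>{1..<k}. w (a + t)) + w (a + k)" if "1 \<le> k" for a k
  proof -
    have "wsum w a (Suc k) = (\<Sum>t\<in>{0..k}. w (a + t))"
      unfolding wsum_def by (simp add: atLeast0AtMost lessThan_Suc_atMost)
    also have "{0..k} = insert 0 (insert k {1..<k})" using that by auto
    finally show ?thesis using that by simp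
  qed
  \<comment> \<open>If k is the first place where the middle part differs from its mirror image,
    compare the prefix of length k + 1 of one word with the suffix of length k + 1 of the other. By
    minimality of k the interiors have equal weight, so choosing the pair with ends 1, 1 against 0,
    0 gives an unbalanced pair of length k + 1 < n.\<close>
  have pal: "w (i + k) = w (i + (N - k))" if "1 \<le> k" "k < N" for k
    using that
  proof (induction k rule: less_induct)
    case (less k)
    have k: "1 \<le> k" "k < N" "Suc k < n" using less.prems N by auto
    have sm: "(\<Sum>t\<in>{1..<k}. w (a + t)) = (\<Sum>t\<in>{1..<k}. w (b + (N - t)))"
      if "a = i \<or> a = j" "b = i \<or> b = j" for a b
    proof (rule sum.cong)
      fix t assume t: "t \<in> {1..<k}"
      then have "w (i + t) = w (i + (N - t))" using less by auto
      moreover have "w (a + t) = w (i + t)" using mid[of t] t k that by auto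
      moreover have "w (b + (N - t)) = w (i + (N - t))" using mid[of "N - t"] t k that by auto
      ultimately show "w (a + t) = w (b + (N - t))" by simp
    qed simp
    show ?case
    proof (rule ccontr)
      assume ne: "w (i + k) \<noteq> w (i + (N - k))"
      have mk: "w (j + k) = w (i + k)" "w (j + (N - k)) = w (i + (N - k))"
        using mid[of k] mid[of "N - k"] k by auto
      consider "w (i + k) = 1" "w (i + (N - k)) = 0" | "w (i + k) = 0" "w (i + (N - k)) = 1"
        using ne binary_cases[OF w, of "i + k"] binary_cases[OF w, of "i + (N - k)"] by auto
      then show False
      proof cases
        case 1
        have "wsum w i (Suc k) \<le> wsum w (j + (N - k)) (Suc k) + 1" by (rule min[OF k(3)])
        then show False
          unfolding direct[OF k(1), of i] reflect[OF k(1,2), of j] using sm[of i j] 1 mk first last by simp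
      next
        case 2
        have "wsum w (i + (N - k)) (Suc k) \<le> wsum w j (Suc k) + 1" by (rule min[OF k(3)])
        then show False
          unfolding direct[OF k(1), of j] reflect[OF k(1,2), of i] using sm[of j i] 2 mk first last by simp
      qed
    qed
  qed
  obtain r where r: "right_special w N = {r}" using sturmian_unique_right_special[OF w st] .
  obtain M where M: "N = Suc M" using N by (cases N) auto
  obtain v where v: "right_special w M = {v}" using sturmian_unique_right_special[OF w st] .
  have "factor_at w M (Suc j) \<in> right_special w M"
  proof (rule right_specialI)
    show "factor_at w M (Suc j) = factor_at w M (Suc i)"
      unfolding factor_at_eq_iff
    proof (intro allI impI)
      fix t assume "t < M"
      then show "w (Suc j + t) = w (Suc i + t)" using mid[of "Suc t"] M by simp
    qed
  qed (use last M in auto)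
  then have vj: "v = factor_at w M (Suc j)" using v by simp
  have Nfact: "factor_at w N s = w s # factor_at w M (Suc s)" for s
    by (rule nth_equalityI) (auto simp: M factor_at_def nth_Cons' simp del: upt_Suc)
  have "r \<in> right_special w N" using r by simp
  then obtain s s' where ss: "r @ [0] = factor_at w (Suc N) s" "r @ [1] = factor_at w (Suc N) s'"
    unfolding right_special_def subwords_eq by blast
  then have rs: "r = factor_at w N s" "w (s + N) = 0" "r = factor_at w N s'" "w (s' + N) = 1"
    by (auto simp: factor_at_Suc)
  then have "factor_at w M (Suc s) = factor_at w M (Suc s')"
    using Nfact[of s] Nfact[of s'] by simp
  \<comment> \<open>Removing the first letter of a right special factor leaves a right special
    factor, and v is the only one of length M.\<close>
  with rs have "factor_at w M (Suc s) \<in> right_special w M"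
    by (intro right_specialI[where s' = "Suc s'"]) (auto simp: M)
  then have rv: "r = w s # v" using rs Nfact v by simp
  have "factor_at w M (Suc i) = factor_at w M (Suc j)"
    unfolding factor_at_eq_iff
  proof (intro allI impI)
    fix t assume "t < M"
    then show "w (Suc i + t) = w (Suc j + t)" using mid[of "Suc t"] M by simp
  qed
  then have fi: "factor_at w N i = 1 # v" and fj: "factor_at w N j = 0 # v"
    using Nfact vj first by auto
  \<comment> \<open>An occurrence of 0v at offset q in 1v1 would put the letter 0 at place q. It
    would also match the final 1 of 1v1 with place N - q of 0v0, that is, put 1 at the mirror image
    of q in v. This contradicts the palindrome. The offsets 0 and N fail already at the first
    letter. \<open>noI\<close> is the same argument with the roles exchanged.\<close>
  have noJ: "factor_at w N (i + q) \<noteq> factor_at w N j" if "q \<le> N" for q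
  proof
    assume "factor_at w N (i + q) = factor_at w N j"
    then have eq: "w (i + q + t) = w (j + t)" if "t < N" for t using that by (simp add: factor_at_eq_iff)
    have "q \<noteq> 0" "q \<noteq> N" using eq[of 0] first last N by (auto intro!: gr0I)
    with that have q: "1 \<le> q" "q < N" by auto
    have "w (j + (N - q)) = 1" using eq[of "N - q"] last q by simp
    moreover have "w (i + q) = 0" using eq[of 0] first q by simp
    moreover have "1 \<le> N - q" "N - q < N" using q by auto
    ultimately show False using mid[of "N - q"] pal[of q] q by simp
  qed
  have noI: "factor_at w N (j + q) \<noteq> factor_at w N i" if "q \<le> N" for q
  proof
    assume "factor_at w N (j + q) = factor_at w N i"
    then have eq: "w (j + q + t) = w (i + t)" if "t < N" for t using that by (simp add: factor_at_eq_iff)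
    have "q \<noteq> 0" "q \<noteq> N" using eq[of 0] first last N by (auto intro!: gr0I)
    with that have q: "1 \<le> q" "q < N" by auto
    have "w (i + (N - q)) = 0" using eq[of "N - q"] last q by simp
    moreover have "w (j + q) = 1" using eq[of 0] first q by simp
    ultimately show False using mid[of q] pal[of q] q by simp
  qed
  show False
  proof (cases "w s = 0")
    case True
    then show False
      using sturmian_meets_right_special[OF w st N(2), of i] noJ r rv fj by auto
  next
    case False
    then have "w s = 1" using binary_cases[OF w, of s] by auto
    then show False
      using sturmian_meets_right_special[OF w st N(2), of j] noI r rv fi by auto
  qed
qed

section \<open>Balance of periodic words and deviation from the slope\<close>

lemma periodic_wsum:
  assumes "\<And>i. w (i + p) = w i"
  shows "wsum w i p = wsum w 0 p"
proof (induction i)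
  case (Suc i)
  have "wsum w i (Suc p) = wsum w i p + w i" by (simp add: wsum_Suc assms)
  then show ?case using Suc by (simp add: wsum_Suc_left)
qed simp

text \<open>Whole periods have the same weight wherever they start, so two windows of equal length
  can differ only in their remainders, whose weight is at most p.\<close>

lemma periodic_balanced:
  assumes w: "binary_word w" and p: "p > 0" and per: "\<And>i. w (i + p) = w i"
  shows "wsum w i n \<le> wsum w j n + p"
proof -
  have mult: "wsum w i (q * p) = q * wsum w 0 p" for i q
  proof (induction q arbitrary: i)
    case (Suc q)
    have "wsum w i (Suc q * p) = wsum w i p + wsum w (i + p) (q * p)" by (simp add: wsum_add)
    then show ?case using Suc[of "i + p"] periodic_wsum[of w p i, OF per] by simp
  qed simp
  have n: "n = (n div p) * p + n mod p" by simp
  have "wsum w i n = (n div p) * wsum w 0 p + wsum w (i + (n div p) * p) (n mod p)" for i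
    by (subst n) (simp only: wsum_add mult)
  moreover have "wsum w (i + (n div p) * p) (n mod p) \<le> p"
    by (rule order.trans[OF wsum_le[OF w]]) (use p in \<open>simp add: less_imp_le\<close>)
  ultimately show ?thesis by simp
qed

lemma has_slope_bounds:
  assumes w: "binary_word w" and sl: "has_slope w \<alpha>"
  shows "0 \<le> \<alpha>" "\<alpha> \<le> 1"
proof -
  have lim: "(\<lambda>n. real (\<Sum>i<n. w i) / real n) \<longlonglongrightarrow> \<alpha>" using sl by (simp add: has_slope_def)
  show "0 \<le> \<alpha>" by (rule LIMSEQ_le_const[OF lim]) (auto intro!: divide_nonneg_nonneg sum_nonneg)
  have "real (\<Sum>i<n. w i) / real n \<le> 1" for n
    using wsum_le[OF w, of 0 n] by (cases "n = 0") (auto simp: wsum_def divide_le_eq simp flip: of_nat_sum)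
  then show "\<alpha> \<le> 1" by (intro LIMSEQ_le_const2[OF lim]) auto
qed

text \<open>Cut the prefix of length N n into N blocks of length n. By balance each block has the
  weight of the window at i up to C; dividing by N and letting N grow turns the average block weight
  into n \<alpha>, and the error C survives unchanged.\<close>

lemma balanced_slope:
  assumes sl: "has_slope w \<alpha>" and bal: "\<And>i j n. wsum w i n \<le> wsum w j n + C"
  shows "\<bar>real (wsum w i n) - real n * \<alpha>\<bar> \<le> real C"
proof (cases "n = 0")
  case False
  have blocks: "wsum w 0 (N * n) \<le> N * (wsum w i n + C) \<and> N * wsum w i n \<le> wsum w 0 (N * n) + N * C" for N
  proof (induction N)
    case (Suc N)
    have "wsum w 0 (Suc N * n) = wsum w 0 (N * n) + wsum w (N * n) n"
      using wsum_add[of w 0 "N * n" n] by (simp add: add.commute)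
    then show ?case using Suc bal[of "N * n" n i] bal[of i n "N * n"] by simp
  qed simp
  have "(\<lambda>n. real (\<Sum>i<n. w i) / real n) \<longlonglongrightarrow> \<alpha>" using sl by (simp add: has_slope_def)
  moreover have "strict_mono (\<lambda>N. Suc N * n)" using False by (auto simp: strict_mono_Suc_iff)
  ultimately have "((\<lambda>n. real (\<Sum>i<n. w i) / real n) \<circ> (\<lambda>N. Suc N * n)) \<longlonglongrightarrow> \<alpha>"
    by (rule LIMSEQ_subseq_LIMSEQ)
  then have "(\<lambda>N. real (wsum w 0 (Suc N * n)) / real (Suc N * n) * real n) \<longlonglongrightarrow> \<alpha> * real n"
    by (intro tendsto_mult tendsto_const) (simp add: o_def wsum_def)
  moreover have "real (wsum w 0 (Suc N * n)) / real (Suc N * n) * real n = real (wsum w 0 (Suc N * n)) / real (Suc N)" for N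
    using False by (simp only: of_nat_mult) (simp del: of_nat_Suc)
  ultimately have lim: "(\<lambda>N. real (wsum w 0 (Suc N * n)) / real (Suc N)) \<longlonglongrightarrow> \<alpha> * real n" by simp
  have "real (wsum w 0 (Suc N * n)) / real (Suc N) \<le> real (wsum w i n + C)" for N
    using blocks[of "Suc N"] by (simp add: divide_le_eq mult.commute flip: of_nat_mult of_nat_add del: of_nat_Suc)
  then have 1: "\<alpha> * real n \<le> real (wsum w i n + C)" by (intro LIMSEQ_le_const2[OF lim]) auto
  have "real (wsum w i n) - real C \<le> real (wsum w 0 (Suc N * n)) / real (Suc N)" for N
  proof -
    have "real (Suc N * wsum w i n) \<le> real (wsum w 0 (Suc N * n) + Suc N * C)"
      using blocks[of "Suc N"] by (simp only: of_nat_le_iff)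
    then have "(real (wsum w i n) - real C) * real (Suc N) \<le> real (wsum w 0 (Suc N * n))"
      by (simp add: algebra_simps)
    then show ?thesis by (simp add: le_divide_eq del: of_nat_Suc)
  qed
  then have 2: "real (wsum w i n) - real C \<le> \<alpha> * real n" by (intro LIMSEQ_le_const[OF lim]) auto
  from 1 2 show ?thesis by (simp add: abs_le_iff algebra_simps)
qed simp

text \<open>The two consequences through which the hypothesis on w enters everything that follows: C
  is a period in the periodic case and 1 in the Sturmian case.\<close>

lemma periodic_or_sturmian_balanced:
  assumes "binary_word w" "periodic_word w \<or> sturmian w"
  obtains C where "\<And>i j n. wsum w i n \<le> wsum w j n + C" "\<And>n. complexity w n \<le> n + C"
  using assms(2)
proof
  assume "periodic_word w"
  then obtain p where p: "p > 0" "\<And>i. w (i + p) = w i" by (auto simp: periodic_word_def)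
  show thesis
  proof (rule that)
    show "wsum w i n \<le> wsum w j n + p" for i j n by (rule periodic_balanced[OF assms(1) p])
    show "complexity w n \<le> n + p" for n
      using eventually_periodic_complexity[of p 0 w n] p by (simp add: trans_le_add2)
  qed
next
  assume "sturmian w"
  then show thesis
    using sturmian_balanced[OF assms(1)] sturmian_complexity by (intro that[of 1]) auto
qed

section \<open>Codimensions and coefficient sums\<close>

lemma vector_space_poly_scale: "vector_space (poly_scale :: 'a::field \<Rightarrow> ('v mtree \<Rightarrow> 'a) \<Rightarrow> _)"
  by unfold_locales (auto simp: poly_scale_def fun_eq_iff algebra_simps)

interpretation poly: vector_space "poly_scale :: 'a::field \<Rightarrow> ('v mtree \<Rightarrow> 'a) \<Rightarrow> _"
  by (rule vector_space_poly_scale)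

definition coeff_sum :: "'v mtree set \<Rightarrow> ('v mtree \<Rightarrow> 'a::field) \<Rightarrow> 'a" where
  "coeff_sum M f = (\<Sum>t\<in>M. f t)"

definition coeff_ker :: "'v mtree set \<Rightarrow> ('v mtree \<Rightarrow> 'a::field) set" where
  "coeff_ker M = {f. coeff_sum M f = 0}"

text \<open>Serves both as the polynomial consisting of one monomial and as a basis vector of the
  algebra.\<close>

definition delta :: "'b \<Rightarrow> 'b \<Rightarrow> 'a::field" where
  "delta t = (\<lambda>s. if s = t then 1 else 0)"

lemma coeff_sum_add: "coeff_sum M (f + g) = coeff_sum M f + coeff_sum M g"
  by (simp add: coeff_sum_def sum.distrib)

lemma coeff_sum_diff: "coeff_sum M (f - g) = coeff_sum M f - coeff_sum M g"
  by (simp add: coeff_sum_def sum_subtractf)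

lemma coeff_sum_scale: "coeff_sum M (poly_scale c f) = c * coeff_sum M f"
  by (simp add: coeff_sum_def poly_scale_def sum_distrib_left)

lemma subspace_multilin: "poly.subspace (multilin_polys V)"
  unfolding poly.subspace_def by (auto simp: multilin_polys_def poly_scale_def) (metis add.right_neutral)

lemma subspace_coeff_ker: "poly.subspace (coeff_ker M)"
  unfolding poly.subspace_def
  by (auto simp: coeff_ker_def coeff_sum_add coeff_sum_scale) (simp add: coeff_sum_def)

lemma delta_multilin: "t \<in> mono_set V \<Longrightarrow> delta t \<in> multilin_polys V"
  by (auto simp: multilin_polys_def delta_def)

lemma leaves_nonempty [simp]: "leaves t \<noteq> []"
  by (induction t) auto

lemma finite_trees_length: "finite V \<Longrightarrow> finite {t. set (leaves t) \<subseteq> V \<and> length (leaves t) \<le> n}"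
proof (induction n)
  case 0
  then show ?case by simp
next
  case (Suc n)
  let ?A = "{t. set (leaves t) \<subseteq> V \<and> length (leaves t) \<le> n}"
  have "{t. set (leaves t) \<subseteq> V \<and> length (leaves t) \<le> Suc n} \<subseteq> Leaf ` V \<union> case_prod Node ` (?A \<times> ?A)"
  proof
    fix t assume t: "t \<in> {t. set (leaves t) \<subseteq> V \<and> length (leaves t) \<le> Suc n}"
    show "t \<in> Leaf ` V \<union> case_prod Node ` (?A \<times> ?A)"
    proof (cases t)
      case (Node l r)
      have "1 \<le> length (leaves l)" "1 \<le> length (leaves r)" by (simp_all add: Suc_le_eq)
      then have "l \<in> ?A" "r \<in> ?A" using t Node by (auto intro: add_le_imp_le_left add_le_imp_le_right)
      then show ?thesis using Node by auto
    qed (use t in auto)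
  qed
  moreover have "finite (Leaf ` V \<union> case_prod Node ` (?A \<times> ?A))" using Suc by simp
  ultimately show ?case by (rule finite_subset)
qed

lemma finite_mono_set: "finite V \<Longrightarrow> finite (mono_set V)"
proof (rule finite_subset[of _ "{t. set (leaves t) \<subseteq> V \<and> length (leaves t) \<le> card V}"])
  show "mono_set V \<subseteq> {t. set (leaves t) \<subseteq> V \<and> length (leaves t) \<le> card V}"
    by (auto simp: mono_set_def distinct_card[symmetric])
qed (rule finite_trees_length)

lemma multilin_span:
  assumes "finite V"
  shows "multilin_polys V \<subseteq> poly.span (delta ` mono_set V :: ('v mtree \<Rightarrow> 'a::field) set)"
proof
  fix f :: "'v mtree \<Rightarrow> 'a" assume f: "f \<in> multilin_polys V"
  have "f = (\<Sum>t\<in>mono_set V. poly_scale (f t) (delta t))"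
  proof
    fix s
    have "(\<Sum>t\<in>T. poly_scale (f t) (delta t)) s = (\<Sum>t\<in>T. if t = s then f t else 0)" for T
      by (induction T rule: infinite_finite_induct) (auto simp: poly_scale_def delta_def)
    also have "(\<Sum>t\<in>mono_set V. if t = s then f t else 0) = f s" using f finite_mono_set[OF assms] by (auto simp: multilin_polys_def)
    finally show "f s = (\<Sum>t\<in>mono_set V. poly_scale (f t) (delta t)) s" by simp
  qed
  also have "\<dots> \<in> poly.span (delta ` mono_set V)"
    by (intro poly.span_sum poly.span_scale poly.span_base) auto
  finally show "f \<in> poly.span (delta ` mono_set V)" .
qed

lemma finite_independent_multilin:
  assumes "finite V" "B \<subseteq> multilin_polys V" "poly.independent B"
  shows "finite B"
  using poly.independent_span_bound[of "delta ` mono_set V" B] multilin_span[OF assms(1)] assms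
    finite_mono_set[OF assms(1)] by auto

text \<open>Dimension is not monotone in general, since an infinite basis has \<open>card\<close> 0.
  Inside \<open>multilin_polys V\<close> with V finite every independent set is finite, which
  excludes this.\<close>

lemma multilin_dim_mono:
  assumes "finite V" "A \<subseteq> B" "B \<subseteq> multilin_polys V"
  shows "poly.dim A \<le> poly.dim B"
proof -
  obtain C where C: "C \<subseteq> B" "poly.independent C" "B \<subseteq> poly.span C" "card C = poly.dim B"
    using poly.basis_exists[of B] by blast
  have "finite C" using finite_independent_multilin[OF assms(1)] C assms(3) by blast
  then have "poly.dim A \<le> card C" using C assms by (intro poly.dim_le_card) auto
  then show ?thesis using C by simp
qed

text \<open>A hyperplane section: if h lies outside the kernel, subtracting a suitable multiple of h
  moves any element of U into the kernel, so h together with a basis of the section is a basis of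
  U.\<close>

lemma dim_inter_coeff_ker:
  fixes U :: "('v mtree \<Rightarrow> 'a::field) set"
  assumes V: "finite V" and U: "poly.subspace U" "U \<subseteq> multilin_polys V"
  shows "poly.dim U \<le> poly.dim (U \<inter> coeff_ker M) + 1"
    and "h \<in> U \<Longrightarrow> coeff_sum M h \<noteq> 0 \<Longrightarrow> poly.dim (U \<inter> coeff_ker M) + 1 \<le> poly.dim U"
proof -
  let ?K = "U \<inter> coeff_ker M"
  obtain C where C: "C \<subseteq> ?K" "poly.independent C" "?K \<subseteq> poly.span C" "card C = poly.dim ?K"
    using poly.basis_exists[of ?K] by blast
  have fin: "finite C" using finite_independent_multilin[OF V] C U by blast
  have *: "poly.dim U = poly.dim ?K + 1" if h: "h \<in> U" "coeff_sum M h \<noteq> 0" for h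
  proof -
    have subK: "poly.span C \<subseteq> coeff_ker M" using C by (intro poly.span_minimal subspace_coeff_ker) auto
    have hC: "h \<notin> poly.span C" using subK h by (auto simp: coeff_ker_def)
    have ind: "poly.independent (insert h C)" using C hC by (simp add: poly.independent_insert)
    have "f \<in> poly.span (insert h C)" if f: "f \<in> U" for f
    proof -
      let ?c = "coeff_sum M f / coeff_sum M h"
      have "f - poly_scale ?c h \<in> ?K"
        using f h by (auto simp: coeff_ker_def coeff_sum_diff coeff_sum_scale
            intro!: poly.subspace_diff[OF U(1)] poly.subspace_scale[OF U(1)])
      then have "f - poly_scale ?c h \<in> poly.span C" using C by blast
      then show ?thesis unfolding poly.span_insert by blast
    qed
    then have "card (insert h C) = poly.dim U" using C h ind by (intro poly.basis_card_eq_dim) auto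
    moreover have "h \<notin> C" using hC poly.span_base by blast
    ultimately show ?thesis using fin C by simp
  qed
  show "poly.dim U \<le> poly.dim ?K + 1"
  proof (cases "\<exists>h\<in>U. coeff_sum M h \<noteq> 0")
    case True
    then show ?thesis using * by auto
  next
    case False
    then have "?K = U" by (auto simp: coeff_ker_def)
    then show ?thesis by simp
  qed
  show "h \<in> U \<Longrightarrow> coeff_sum M h \<noteq> 0 \<Longrightarrow> poly.dim ?K + 1 \<le> poly.dim U" using * by auto
qed

section \<open>Codimension as a number of independent coefficient sums\<close>

definition coeff_kers :: "'v set \<Rightarrow> 'v mtree set set \<Rightarrow> ('v mtree \<Rightarrow> 'a::field) set" where
  "coeff_kers V \<M> = {f \<in> multilin_polys V. \<forall>M\<in>\<M>. coeff_sum M f = 0}"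

lemma coeff_kers_insert: "coeff_kers V (insert M \<M>) = coeff_kers V \<M> \<inter> coeff_ker M"
  by (auto simp: coeff_kers_def coeff_ker_def)

lemma coeff_kers_sub: "coeff_kers V \<M> \<subseteq> (multilin_polys V :: ('v mtree \<Rightarrow> 'a::field) set)"
  by (auto simp: coeff_kers_def)

lemma subspace_coeff_kers: "poly.subspace (coeff_kers V \<M> :: ('v mtree \<Rightarrow> 'a::field) set)"
proof -
  have "coeff_kers V \<M> = multilin_polys V \<inter> (\<Inter>M\<in>\<M>. coeff_ker M :: ('v mtree \<Rightarrow> 'a) set)"
    by (auto simp: coeff_kers_def coeff_ker_def)
  moreover have "poly.subspace (\<Inter>M\<in>\<M>. coeff_ker M :: ('v mtree \<Rightarrow> 'a) set)"
    by (rule poly.subspace_Int) (rule subspace_coeff_ker)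
  ultimately show ?thesis by (simp add: poly.subspace_inter subspace_multilin)
qed

lemma dim_coeff_kers_ge:
  assumes "finite V" "finite \<M>"
  shows "poly.dim (multilin_polys V :: ('v mtree \<Rightarrow> 'a::field) set)
    \<le> poly.dim (coeff_kers V \<M> :: ('v mtree \<Rightarrow> 'a) set) + card \<M>"
  using assms(2)
proof (induction \<M>)
  case empty
  then show ?case by (simp add: coeff_kers_def)
next
  case (insert M \<M>)
  then show ?case
    using dim_inter_coeff_ker(1)[OF assms(1) subspace_coeff_kers coeff_kers_sub, where 'a = 'a, of \<M> M]
    by (simp add: coeff_kers_insert)
qed

text \<open>Sums over disjoint nonempty sets of monomials are independent functionals: a single
  monomial from M lies in the kernel of all the others but not in that of M, so each set lowers the
  dimension by exactly one.\<close>

lemma dim_coeff_kers_le: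
  assumes "finite V" "finite \<M>" "\<And>M. M \<in> \<M> \<Longrightarrow> M \<noteq> {} \<and> M \<subseteq> mono_set V"
    and "\<And>M N. M \<in> \<M> \<Longrightarrow> N \<in> \<M> \<Longrightarrow> M \<noteq> N \<Longrightarrow> M \<inter> N = {}"
  shows "poly.dim (coeff_kers V \<M> :: ('v mtree \<Rightarrow> 'a::field) set) + card \<M>
    \<le> poly.dim (multilin_polys V :: ('v mtree \<Rightarrow> 'a) set)"
  using assms(2,3,4)
proof (induction \<M>)
  case empty
  then show ?case by (simp add: coeff_kers_def)
next
  case (insert M \<M>)
  obtain t where t: "t \<in> M" "t \<in> mono_set V" using insert.prems(1)[of M] by auto
  have sum_delta: "coeff_sum N (delta t :: _ \<Rightarrow> 'a) = (if t \<in> N then 1 else 0)" if "N \<subseteq> mono_set V" for N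
    using that finite_subset[OF that finite_mono_set[OF assms(1)]] by (simp add: coeff_sum_def delta_def)
  have "t \<notin> N" if "N \<in> \<M>" for N
    using insert.prems(2)[of M N] that t insert.hyps by auto
  then have "(delta t :: _ \<Rightarrow> 'a) \<in> coeff_kers V \<M>"
    using sum_delta insert.prems(1) t by (auto simp: coeff_kers_def delta_multilin)
  moreover have "coeff_sum M (delta t :: _ \<Rightarrow> 'a) \<noteq> 0"
    using sum_delta[of M] insert.prems(1)[of M] t by simp
  ultimately have "poly.dim (coeff_kers V \<M> \<inter> coeff_ker M :: ('v mtree \<Rightarrow> 'a) set) + 1
      \<le> poly.dim (coeff_kers V \<M> :: ('v mtree \<Rightarrow> 'a) set)"
    using dim_inter_coeff_ker(2)[OF assms(1) subspace_coeff_kers coeff_kers_sub, of "delta t :: _ \<Rightarrow> 'a" \<M> M] by blast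
  moreover have "poly.dim (coeff_kers V \<M> :: ('v mtree \<Rightarrow> 'a) set) + card \<M>
    \<le> poly.dim (multilin_polys V :: ('v mtree \<Rightarrow> 'a) set)"
    by (rule insert.IH) (use insert.prems in blast)+
  ultimately show ?case using insert.hyps by (simp add: coeff_kers_insert)
qed

lemma codim_le:
  assumes "finite V" "finite \<M>"
    and "\<And>f :: 'v mtree \<Rightarrow> 'a::field. f \<in> coeff_kers V \<M> \<Longrightarrow> f \<in> ident_part mul S V"
  shows "codim mul S V TYPE('v mtree \<Rightarrow> 'a) \<le> card \<M>"
proof -
  have "poly.dim (coeff_kers V \<M> :: ('v mtree \<Rightarrow> 'a) set) \<le> poly.dim (ident_part mul S V :: ('v mtree \<Rightarrow> 'a) set)"
    by (rule multilin_dim_mono[OF assms(1)]) (use assms(3) in \<open>auto simp: ident_part_def\<close>)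
  then show ?thesis using dim_coeff_kers_ge[OF assms(1,2), where 'a = 'a] by (simp add: codim_def)
qed

lemma codim_ge:
  assumes "finite V" "finite \<M>" "\<And>M. M \<in> \<M> \<Longrightarrow> M \<noteq> {} \<and> M \<subseteq> mono_set V"
    and "\<And>M N. M \<in> \<M> \<Longrightarrow> N \<in> \<M> \<Longrightarrow> M \<noteq> N \<Longrightarrow> M \<inter> N = {}"
    and "\<And>f :: 'v mtree \<Rightarrow> 'a::field. f \<in> ident_part mul S V \<Longrightarrow> f \<in> coeff_kers V \<M>"
  shows "card \<M> \<le> codim mul S V TYPE('v mtree \<Rightarrow> 'a)"
proof -
  have "poly.dim (ident_part mul S V :: ('v mtree \<Rightarrow> 'a) set) \<le> poly.dim (coeff_kers V \<M> :: ('v mtree \<Rightarrow> 'a) set)"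
    by (rule multilin_dim_mono[OF assms(1)]) (use assms(5) coeff_kers_sub in auto)
  then show ?thesis using dim_coeff_kers_le[OF assms(1-4), where 'a = 'a] by (simp add: codim_def)
qed

section \<open>Multilinear values in the algebra\<close>

text \<open>The indices (i, j) of the p-th vector on the line, with p counted from 0, so that
  position 0 is the generator z_1^(1). The letter leading from position p to p + 1 is b exactly when
  block i is finished, which is what \<open>b_step\<close> records.\<close>

fun state :: "(nat \<Rightarrow> nat) \<Rightarrow> nat \<Rightarrow> nat \<times> nat" where
  "state k 0 = (1, 1)"
| "state k (Suc p) = (case state k p of (i, j) \<Rightarrow> if j < k i then (i, Suc j) else (Suc i, 1))"

definition zpos :: "(nat \<Rightarrow> nat) \<Rightarrow> nat \<Rightarrow> gen" where
  "zpos k p = (case state k p of (i, j) \<Rightarrow> GZ i j)"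

definition b_step :: "(nat \<Rightarrow> nat) \<Rightarrow> nat \<Rightarrow> bool" where
  "b_step k p = (case state k p of (i, j) \<Rightarrow> j = k i)"

definition letter_gen :: "bool \<Rightarrow> gen" where
  "letter_gen c = (if c then GB else GA)"

lemma state_Suc_b_step:
  "fst (state k (Suc p)) = (if snd (state k p) < k (fst (state k p)) then fst (state k p) else Suc (fst (state k p)))"
  "snd (state k (Suc p)) = (if snd (state k p) < k (fst (state k p)) then Suc (snd (state k p)) else 1)"
  by (auto split: prod.split)

lemma zpos_fst_snd: "zpos k p = GZ (fst (state k p)) (snd (state k p))"
  by (simp add: zpos_def split: prod.split)

lemma b_step_fst_snd: "b_step k p \<longleftrightarrow> snd (state k p) = k (fst (state k p))"
  by (simp add: b_step_def split: prod.split)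

lemma supp_finite: "u \<in> alg_carrier k \<Longrightarrow> finite (supp u)"
  and supp_basis: "u \<in> alg_carrier k \<Longrightarrow> e \<in> supp u \<Longrightarrow> e \<in> basis_set k"
  by (auto simp: alg_carrier_def)

locale block_lengths =
  fixes k :: "nat \<Rightarrow> nat"
  assumes k_pos: "\<And>i. k i \<ge> 1"
begin

lemma state_bounds: "1 \<le> fst (state k p) \<and> 1 \<le> snd (state k p) \<and> snd (state k p) \<le> k (fst (state k p))"
proof (induction p)
  case 0
  then show ?case using k_pos[of 1] by simp
next
  case (Suc p)
  then show ?case using k_pos[of "Suc (fst (state k p))"] unfolding state_Suc_b_step by auto
qed

text \<open>The line runs through the pairs (i, j) in lexicographic order; this makes
  \<open>zpos\<close> injective.\<close>

lemma state_less:
  assumes "p < p'"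
  shows "fst (state k p) < fst (state k p') \<or> fst (state k p) = fst (state k p') \<and> snd (state k p) < snd (state k p')"
  using assms
proof (induction p')
  case (Suc p')
  then show ?case using state_bounds[of p] unfolding state_Suc_b_step less_Suc_eq by (auto split: if_splits)
qed simp

lemma inj_zpos: "zpos k p = zpos k p' \<longleftrightarrow> p = p'"
proof
  assume "zpos k p = zpos k p'"
  then show "p = p'"
    using state_less[of p p'] state_less[of p' p] by (cases p p' rule: linorder_cases) (auto simp: zpos_fst_snd)
qed simp

lemma zpos_surj:
  assumes "1 \<le> i" "1 \<le> j" "j \<le> k i"
  shows "\<exists>p. state k p = (i, j)"
  using assms(1) assms(2,3)
proof (induction i arbitrary: j rule: dec_induct)
  case base
  from base show ?case
  proof (induction j rule: dec_induct)
    case base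
    then show ?case by (intro exI[of _ 0]) simp
  next
    case (step j)
    then obtain p where "state k p = (1, j)" by auto
    with step show ?case by (intro exI[of _ "Suc p"]) auto
  qed
next
  case (step i)
  from step.prems show ?case
  proof (induction j rule: dec_induct)
    case base
    obtain p where "state k p = (i, k i)" using step.IH[of "k i"] k_pos[of i] by auto
    then show ?case by (intro exI[of _ "Suc p"]) auto
  next
    case (step j)
    then obtain p where "state k p = (Suc i, j)" by auto
    with step show ?case by (intro exI[of _ "Suc p"]) auto
  qed
qed

lemma basis_set_eq: "basis_set k = {GA, GB} \<union> range (zpos k)"
proof -
  have "{GZ i j | i j. 1 \<le> i \<and> 1 \<le> j \<and> j \<le> k i} = range (zpos k)"
  proof
    show "{GZ i j | i j. 1 \<le> i \<and> 1 \<le> j \<and> j \<le> k i} \<subseteq> range (zpos k)"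
    proof clarify
      fix i j assume "1 \<le> i" "1 \<le> j" "j \<le> k i"
      then obtain p where "state k p = (i, j)" using zpos_surj by blast
      then have "GZ i j = zpos k p" by (simp add: zpos_def)
      then show "GZ i j \<in> range (zpos k)" by blast
    qed
    show "range (zpos k) \<subseteq> {GZ i j | i j. 1 \<le> i \<and> 1 \<le> j \<and> j \<le> k i}"
      using state_bounds by (auto simp: zpos_fst_snd)
  qed
  then show ?thesis by (simp add: basis_set_def)
qed

lemma zpos_in_basis: "zpos k p \<in> basis_set k"
  by (simp add: basis_set_eq)

lemma zpos_neq [simp]: "zpos k p \<noteq> GA" "zpos k p \<noteq> GB" "GA \<noteq> zpos k p" "GB \<noteq> zpos k p"
  by (auto simp: zpos_fst_snd)

text \<open>The multiplication table rewritten along the line: at each position exactly one letter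
  acts without giving zero. All later computations use the table in this form.\<close>

lemma mulb_iff:
  assumes "e \<in> basis_set k"
  shows "mulb k e e' = Some g \<longleftrightarrow> (\<exists>p. e = zpos k p \<and> e' = letter_gen (b_step k p) \<and> g = zpos k (Suc p))"
proof (cases "e \<in> range (zpos k)")
  case True
  then obtain p where p: "e = zpos k p" by blast
  have "mulb k e e' = Some g \<longleftrightarrow> e' = letter_gen (b_step k p) \<and> g = zpos k (Suc p)"
    using state_bounds[of p] unfolding p zpos_fst_snd b_step_fst_snd state_Suc_b_step letter_gen_def
    by (cases e') auto
  then show ?thesis using p inj_zpos by auto
next
  case False
  then have "e = GA \<or> e = GB" using assms by (auto simp: basis_set_eq)
  then show ?thesis by auto
qed

lemma alg_mul_eq:
  assumes "u \<in> alg_carrier k"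
  shows "alg_mul k u v g = (\<Sum>e\<in>supp u. \<Sum>e'\<in>supp v.
       (if \<exists>p. e = zpos k p \<and> e' = letter_gen (b_step k p) \<and> g = zpos k (Suc p) then u e * v e' else 0))"
  unfolding alg_mul_def
  by (intro sum.cong refl if_cong) (simp add: mulb_iff supp_basis[OF assms])

lemma alg_mul_zpos_Suc:
  assumes u: "u \<in> alg_carrier k" and v: "v \<in> alg_carrier k"
  shows "alg_mul k u v (zpos k (Suc p)) = u (zpos k p) * v (letter_gen (b_step k p))"
proof -
  have "alg_mul k u v (zpos k (Suc p)) = (\<Sum>e\<in>supp u. \<Sum>e'\<in>supp v.
       (if e = zpos k p then (if e' = letter_gen (b_step k p) then u e * v e' else 0) else 0))"
    unfolding alg_mul_eq[OF u] by (intro sum.cong refl) (auto simp: inj_zpos)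
  also have "\<dots> = (\<Sum>e\<in>supp u. if e = zpos k p then u e * v (letter_gen (b_step k p)) else 0)"
  proof (rule sum.cong)
    fix e assume "e \<in> supp u"
    show "(\<Sum>e'\<in>supp v. (if e = zpos k p then (if e' = letter_gen (b_step k p) then u e * v e' else 0) else 0))
        = (if e = zpos k p then u e * v (letter_gen (b_step k p)) else 0)"
      using supp_finite[OF v] by (auto simp: supp_def)
  qed simp
  also have "\<dots> = u (zpos k p) * v (letter_gen (b_step k p))"
    using supp_finite[OF u] by (auto simp: supp_def)
  finally show ?thesis .
qed

lemma alg_mul_other:
  assumes u: "u \<in> alg_carrier k" and g: "g \<notin> zpos k ` {0<..}"
  shows "alg_mul k u v g = 0"
proof -
  have "g \<noteq> zpos k (Suc p)" for p using g by auto
  then show ?thesis unfolding alg_mul_eq[OF u] by simp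
qed

lemma alg_mul_zpos_0: "u \<in> alg_carrier k \<Longrightarrow> alg_mul k u v (zpos k 0) = 0"
  by (rule alg_mul_other) (auto simp: inj_zpos)

lemma alg_mul_closed:
  assumes u: "u \<in> alg_carrier k" and v: "v \<in> alg_carrier k"
  shows "alg_mul k u v \<in> alg_carrier k"
proof -
  have "supp (alg_mul k u v) \<subseteq> zpos k ` (Suc ` (zpos k -` supp u))"
  proof
    fix g assume g: "g \<in> supp (alg_mul k u v)"
    then obtain p where p: "g = zpos k (Suc p)"
      using alg_mul_other[OF u, of g v] by (force simp: supp_def gr0_conv_Suc)
    then have "u (zpos k p) \<noteq> 0" using g by (auto simp: supp_def alg_mul_zpos_Suc[OF u v])
    then show "g \<in> zpos k ` (Suc ` (zpos k -` supp u))" using p by (auto simp: supp_def)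
  qed
  moreover have "finite (zpos k -` supp u)"
    using supp_finite[OF u] by (rule finite_vimageI) (simp add: inj_def inj_zpos)
  ultimately show ?thesis
    using zpos_in_basis by (auto simp: alg_carrier_def intro: finite_subset)
qed

lemma mon_eval_closed:
  "(\<And>v. \<sigma> v \<in> alg_carrier k) \<Longrightarrow> mon_eval (alg_mul k) \<sigma> t \<in> alg_carrier k"
  by (induction t) (simp_all add: alg_mul_closed)

section \<open>Left-normed monomials and their classes\<close>

definition left_normed :: "'v \<Rightarrow> 'v list \<Rightarrow> 'v mtree" where
  "left_normed v vs = foldl (\<lambda>t x. Node t (Leaf x)) (Leaf v) vs"

lemma left_normed_Nil [simp]: "left_normed v [] = Leaf v"
  and left_normed_snoc [simp]: "left_normed v (vs @ [x]) = Node (left_normed v vs) (Leaf x)"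
  by (simp_all add: left_normed_def)

lemma leaves_left_normed [simp]: "leaves (left_normed v vs) = v # vs"
  by (induction vs rule: rev_induct) auto

lemma left_normed_eq_iff [simp]: "left_normed v vs = left_normed v' vs' \<longleftrightarrow> v = v' \<and> vs = vs'"
  by (metis leaves_left_normed list.inject)

text \<open>A product has only z-coordinates, so as a right factor it offers neither a nor b and
  kills the monomial. A nonzero monomial therefore has a leaf as its right factor, and the argument
  descends into the left factor.\<close>

lemma mon_eval_not_left_normed:
  assumes \<sigma>: "\<And>v. \<sigma> v \<in> (alg_carrier k :: (gen \<Rightarrow> 'a::field) set)" and t: "\<nexists>v vs. t = left_normed v vs"
  shows "mon_eval (alg_mul k) \<sigma> t = (\<lambda>_. 0)"
  using t
proof (induction t)
  case (Leaf v)
  then show ?case by (metis left_normed_Nil)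
next
  case (Node l r)
  let ?l = "mon_eval (alg_mul k) \<sigma> l" and ?r = "mon_eval (alg_mul k) \<sigma> r"
  have cl: "?l \<in> alg_carrier k" "?r \<in> alg_carrier k" by (simp_all add: mon_eval_closed \<sigma>)
  have zero: "mon_eval (alg_mul k) \<sigma> (Node l r) = (\<lambda>_. 0)"
    if "\<And>p. ?l (zpos k p) * ?r (letter_gen (b_step k p)) = 0"
  proof
    fix g
    show "mon_eval (alg_mul k) \<sigma> (Node l r) g = 0"
    proof (cases "g \<in> zpos k ` {0<..}")
      case True
      then obtain p where "g = zpos k (Suc p)" by (auto simp: gr0_conv_Suc)
      then show ?thesis using that by (simp add: alg_mul_zpos_Suc[OF cl])
    next
      case False
      then show ?thesis by (simp add: alg_mul_other[OF cl(1)])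
    qed
  qed
  show ?case
  proof (cases r)
    case (Leaf x)
    have "\<nexists>v vs. l = left_normed v vs" using Node.prems Leaf by (metis left_normed_snoc)
    then have "?l = (\<lambda>_. 0)" by (rule Node.IH)
    then show ?thesis by (intro zero) simp
  next
    case (Node a b)
    have "?r (letter_gen c) = 0" for c
      unfolding Node mon_eval.simps
      by (rule alg_mul_other) (auto simp: mon_eval_closed \<sigma> letter_gen_def)
    then show ?thesis by (intro zero) simp
  qed
qed

text \<open>Only one path of the given length ends at a given position, and its start and letters
  are determined; so the coordinate is a single product instead of a sum.\<close>

lemma mon_eval_left_normed:
  assumes \<sigma>: "\<And>v. \<sigma> v \<in> (alg_carrier k :: (gen \<Rightarrow> 'a::field) set)"
  shows "mon_eval (alg_mul k) \<sigma> (left_normed v vs) (zpos k (p + length vs))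
    = \<sigma> v (zpos k p) * (\<Prod>i<length vs. \<sigma> (vs ! i) (letter_gen (b_step k (p + i))))"
proof (induction vs rule: rev_induct)
  case (snoc x vs)
  have "mon_eval (alg_mul k) \<sigma> (left_normed v (vs @ [x])) (zpos k (Suc (p + length vs)))
      = mon_eval (alg_mul k) \<sigma> (left_normed v vs) (zpos k (p + length vs)) * \<sigma> x (letter_gen (b_step k (p + length vs)))"
    by (simp add: alg_mul_zpos_Suc mon_eval_closed \<sigma>)
  moreover have "(\<Prod>i<length vs. \<sigma> ((vs @ [x]) ! i) (letter_gen (b_step k (p + i)))) = (\<Prod>i<length vs. \<sigma> (vs ! i) (letter_gen (b_step k (p + i))))"
    by (intro prod.cong) (auto simp: nth_append)
  ultimately show ?case using snoc by (simp add: mult.assoc)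
qed simp

lemma mon_eval_left_normed_less:
  assumes \<sigma>: "\<And>v. \<sigma> v \<in> (alg_carrier k :: (gen \<Rightarrow> 'a::field) set)" and "q < length vs"
  shows "mon_eval (alg_mul k) \<sigma> (left_normed v vs) (zpos k q) = 0"
  using assms(2)
proof (induction vs arbitrary: q rule: rev_induct)
  case (snoc x vs)
  then show ?case
    by (cases q) (simp_all add: alg_mul_zpos_Suc alg_mul_zpos_0 mon_eval_closed \<sigma>)
qed simp

lemma mon_eval_left_normed_nonbasis:
  assumes \<sigma>: "\<And>v. \<sigma> v \<in> (alg_carrier k :: (gen \<Rightarrow> 'a::field) set)" and "vs \<noteq> []" "g \<notin> range (zpos k)"
  shows "mon_eval (alg_mul k) \<sigma> (left_normed v vs) g = 0"
proof -
  obtain ws x where "vs = ws @ [x]" using assms(2) by (metis rev_exhaust)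
  then show ?thesis using assms(3) by (auto intro!: alg_mul_other simp: mon_eval_closed \<sigma>)
qed

definition letters :: "nat \<Rightarrow> nat \<Rightarrow> bool list" where
  "letters p N = map (\<lambda>i. b_step k (p + i)) [0..<N]"

text \<open>Left-normed monomials with first variable \<open>v\<close> in which the positions of the letter \<open>b\<close> in
  \<open>u\<close> are occupied by the variables from \<open>S\<close>: the algebra cannot tell these monomials apart.\<close>
definition mono_class :: "'v set \<Rightarrow> 'v \<Rightarrow> bool list \<Rightarrow> 'v set \<Rightarrow> 'v mtree set" where
  "mono_class V v u S = {left_normed v vs | vs. distinct (v # vs) \<and> set (v # vs) = V \<and> map (\<lambda>x. x \<in> S) vs = u}"

lemma mono_class_subset: "mono_class V v u S \<subseteq> mono_set V"
  by (auto simp: mono_class_def mono_set_def)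

lemma mono_class_disjoint:
  assumes "S \<subseteq> V - {v}" "S' \<subseteq> V - {v'}" "t \<in> mono_class V v u S" "t \<in> mono_class V v' u S'"
  shows "v = v'" "S = S'"
proof -
  obtain vs where vs: "t = left_normed v vs" "distinct (v # vs)" "set (v # vs) = V" "map (\<lambda>x. x \<in> S) vs = u"
    using assms(3) by (auto simp: mono_class_def)
  have vs': "v' = v" "map (\<lambda>x. x \<in> S') vs = u"
    using assms(4) vs by (auto simp: mono_class_def)
  then show "v = v'" by simp
  have "\<forall>x\<in>set vs. x \<in> S \<longleftrightarrow> x \<in> S'" using vs(4) vs'(2) by (metis map_eq_conv)
  then show "S = S'" using assms(1,2) vs vs' by auto
qed

lemma card_mono_class:
  assumes "S \<subseteq> V - {v}" "mono_class V v u S \<noteq> {}"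
  shows "card S = length (filter id u)"
proof -
  obtain vs where vs: "distinct (v # vs)" "set (v # vs) = V" "map (\<lambda>x. x \<in> S) vs = u"
    using assms(2) by (auto simp: mono_class_def)
  have "length (filter id u) = length (filter (\<lambda>x. x \<in> S) vs)"
    by (simp add: filter_map o_def flip: vs(3))
  also have "\<dots> = card (set (filter (\<lambda>x. x \<in> S) vs))"
    using vs by (intro distinct_card[symmetric]) simp
  also have "set (filter (\<lambda>x. x \<in> S) vs) = S" using vs assms(1) by auto
  finally show ?thesis ..
qed

lemma arrangement_exists:
  assumes "finite X" "finite Y" "X \<inter> Y = {}" "card Y = length (filter id u)" "card X + card Y = length u"
  shows "\<exists>vs. distinct vs \<and> set vs = X \<union> Y \<and> map (\<lambda>x. x \<in> Y) vs = u"
  using assms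
proof (induction u arbitrary: X Y)
  case Nil
  then show ?case by simp
next
  case (Cons c u)
  show ?case
  proof (cases c)
    case True
    then obtain y where y: "y \<in> Y" using Cons.prems by fastforce
    have c: "card Y = Suc (card (Y - {y}))" using y Cons.prems by (simp only: card.remove)
    obtain vs where vs: "distinct vs" "set vs = X \<union> (Y - {y})" "map (\<lambda>x. x \<in> Y - {y}) vs = u"
      using Cons.IH[of X "Y - {y}"] Cons.prems True c by auto
    have "map (\<lambda>x. x \<in> Y) vs = map (\<lambda>x. x \<in> Y - {y}) vs"
      using vs Cons.prems y by (intro map_cong) auto
    then show ?thesis using vs y True Cons.prems by (intro exI[of _ "y # vs"]) auto
  next
    case False
    have "length (filter id u) \<le> length u" by (rule length_filter_le)
    moreover have "card X + length (filter id u) = Suc (length u)" using Cons.prems False by (simp add: id_def)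
    ultimately have "card X > 0" by linarith
    then obtain x where x: "x \<in> X" by fastforce
    have c: "card X = Suc (card (X - {x}))" using x Cons.prems by (simp only: card.remove)
    obtain vs where vs: "distinct vs" "set vs = X - {x} \<union> Y" "map (\<lambda>x. x \<in> Y) vs = u"
      using Cons.IH[of "X - {x}" Y] Cons.prems False c by auto
    then show ?thesis using x False Cons.prems by (intro exI[of _ "x # vs"]) auto
  qed
qed

lemma mono_class_nonempty:
  assumes "finite V" "v \<in> V" "S \<subseteq> V - {v}" "card S = length (filter id u)" "card V = Suc (length u)"
  shows "mono_class V v u S \<noteq> {}"
proof -
  have S: "finite S" using assms finite_subset by fastforce
  have "V - {v} = (V - {v} - S) \<union> S" using assms by auto
  then have "card (V - {v}) = card (V - {v} - S) + card S"
    using assms S by (metis Diff_disjoint Int_commute card_Un_disjoint finite_Diff)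
  then have "card (V - {v} - S) + card S = length u" using assms by simp
  then obtain vs where vs: "distinct vs" "set vs = (V - {v} - S) \<union> S" "map (\<lambda>x. x \<in> S) vs = u"
    using arrangement_exists[of "V - {v} - S" S u] assms S by auto
  then have "left_normed v vs \<in> mono_class V v u S" using assms by (auto simp: mono_class_def)
  then show ?thesis by blast
qed

text \<open>Reindexing the product over positions as a product over variables removes the order of
  the variables: only v and S remain.\<close>

lemma mon_eval_mono_class:
  assumes \<sigma>: "\<And>v. \<sigma> v \<in> (alg_carrier k :: (gen \<Rightarrow> 'a::field) set)"
    and t: "t \<in> mono_class V v (letters p N) S"
  shows "mon_eval (alg_mul k) \<sigma> t (zpos k (p + N)) = \<sigma> v (zpos k p) * (\<Prod>x\<in>V - {v}. \<sigma> x (letter_gen (x \<in> S)))"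
proof -
  obtain vs where vs: "t = left_normed v vs" "distinct (v # vs)" "set (v # vs) = V" "map (\<lambda>x. x \<in> S) vs = letters p N"
    using t by (auto simp: mono_class_def)
  have len: "length vs = N" using arg_cong[OF vs(4), of length] by (simp add: letters_def)
  have nth: "vs ! i \<in> S \<longleftrightarrow> b_step k (p + i)" if "i < N" for i
    using arg_cong[OF vs(4), of "\<lambda>l. l ! i"] that len by (simp add: letters_def)
  have "V - {v} = set vs" using vs by auto
  then have "V - {v} = (\<lambda>i. vs ! i) ` {..<N}" using len by (auto simp: set_conv_nth)
  moreover have "inj_on (\<lambda>i. vs ! i) {..<N}" using vs len by (auto simp: inj_on_def nth_eq_iff_index_eq)
  ultimately have "(\<Prod>x\<in>V - {v}. \<sigma> x (letter_gen (x \<in> S))) = (\<Prod>i<N. \<sigma> (vs ! i) (letter_gen (vs ! i \<in> S)))"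
    by (simp add: prod.reindex o_def)
  also have "\<dots> = (\<Prod>i<N. \<sigma> (vs ! i) (letter_gen (b_step k (p + i))))"
    by (intro prod.cong) (auto simp: nth)
  finally show ?thesis using mon_eval_left_normed[OF \<sigma>, where v = v and vs = vs and p = p] vs len by simp
qed

lemma poly_eval_zpos:
  assumes \<sigma>: "\<And>v. \<sigma> v \<in> (alg_carrier k :: (gen \<Rightarrow> 'a::field) set)"
    and V: "finite V" "card V = Suc N"
  shows "poly_eval (alg_mul k) \<sigma> V f (zpos k (p + N))
    = (\<Sum>v\<in>V. \<Sum>S\<in>Pow (V - {v}). coeff_sum (mono_class V v (letters p N) S) f
          * (\<sigma> v (zpos k p) * (\<Prod>x\<in>V - {v}. \<sigma> x (letter_gen (x \<in> S)))))"
proof -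
  let ?C = "\<lambda>(v, S). mono_class V v (letters p N) S"
  let ?I = "SIGMA v:V. Pow (V - {v})"
  let ?g = "\<lambda>t. f t * mon_eval (alg_mul k) \<sigma> t (zpos k (p + N))"
  have fin: "finite (mono_set V)" using V by (simp add: finite_mono_set)
  have "poly_eval (alg_mul k) \<sigma> V f (zpos k (p + N)) = sum ?g (mono_set V)"
    by (simp add: poly_eval_def)
  also have "\<dots> = sum ?g (\<Union>i\<in>?I. ?C i)"
  proof (rule sum.mono_neutral_right[OF fin])
    show "(\<Union>i\<in>?I. ?C i) \<subseteq> mono_set V" using mono_class_subset by fastforce
    show "\<forall>t\<in>mono_set V - (\<Union>i\<in>?I. ?C i). ?g t = 0"
    proof
      fix t assume t: "t \<in> mono_set V - (\<Union>i\<in>?I. ?C i)"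
      show "?g t = 0"
      proof (cases "\<exists>v vs. t = left_normed v vs")
        case True
        then obtain v vs where vs: "t = left_normed v vs" by blast
        then have d: "distinct (v # vs)" "set (v # vs) = V" using t by (auto simp: mono_set_def)
        then have len: "length vs = N" using V distinct_card[OF d(1)] by simp
        define S where "S = {vs ! i | i. i < N \<and> b_step k (p + i)}"
        have "map (\<lambda>x. x \<in> S) vs = letters p N"
          using d len by (intro nth_equalityI) (auto simp: S_def letters_def nth_eq_iff_index_eq)
        then have "t \<in> mono_class V v (letters p N) S" using vs d by (auto simp: mono_class_def)
        moreover have "S \<subseteq> V - {v}" "v \<in> V" using d len by (auto simp: S_def)
        ultimately have False using t by auto
        then show ?thesis ..
      next
        case False
        then show ?thesis using mon_eval_not_left_normed[of \<sigma> t, OF \<sigma>] by simp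
      qed
    qed
  qed
  also have "\<dots> = (\<Sum>i\<in>?I. sum ?g (?C i))"
  proof (rule sum.UNION_disjoint)
    show "finite ?I" using V by auto
    show "\<forall>i\<in>?I. finite (?C i)"
      using finite_subset[OF mono_class_subset fin] by auto
    show "\<forall>i\<in>?I. \<forall>j\<in>?I. i \<noteq> j \<longrightarrow> ?C i \<inter> ?C j = {}"
    proof (intro ballI impI equals0I)
      fix i j t assume ij: "i \<in> ?I" "j \<in> ?I" "i \<noteq> j" and t: "t \<in> ?C i \<inter> ?C j"
      obtain v S v' S' where vS: "i = (v, S)" "j = (v', S')" by (cases i, cases j)
      have "v = v' \<and> S = S'"
        using mono_class_disjoint[of S V v S' v' t "letters p N"] ij t unfolding vS by simp
      then show False using ij vS by simp
    qed
  qed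
  also have "\<dots> = (\<Sum>v\<in>V. \<Sum>S\<in>Pow (V - {v}). sum ?g (?C (v, S)))"
  proof -
    have "(\<Sum>v\<in>V. \<Sum>S\<in>Pow (V - {v}). sum ?g (?C (v, S))) = (\<Sum>(v, S)\<in>?I. sum ?g (?C (v, S)))"
      by (rule sum.Sigma) (use V in auto)
    also have "\<dots> = (\<Sum>i\<in>?I. sum ?g (?C i))" by (intro sum.cong) auto
    finally show ?thesis ..
  qed
  also have "\<dots> = (\<Sum>v\<in>V. \<Sum>S\<in>Pow (V - {v}). coeff_sum (mono_class V v (letters p N) S) f
          * (\<sigma> v (zpos k p) * (\<Prod>x\<in>V - {v}. \<sigma> x (letter_gen (x \<in> S)))))"
    by (intro sum.cong refl) (simp add: coeff_sum_def sum_distrib_right mon_eval_mono_class[OF \<sigma>])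
  finally show ?thesis .
qed

text \<open>Coordinates off the line and at positions before N vanish for every monomial, and
  \<open>poly_eval_zpos\<close> expresses the others by coefficient sums. The alternative that the
  product of letter coordinates is 0 is what a graded substitution exploits. \<open>N > 0\<close>
  matters because a single variable may have coordinates at a and b.\<close>

lemma poly_eval_vanishes:
  assumes \<sigma>: "\<And>v. \<sigma> v \<in> (alg_carrier k :: (gen \<Rightarrow> 'a::field) set)"
    and V: "finite V" "card V = Suc N" "N > 0"
    and zero: "\<And>p v S. v \<in> V \<Longrightarrow> S \<subseteq> V - {v} \<Longrightarrow> mono_class V v (letters p N) S \<noteq> {} \<Longrightarrow>
      coeff_sum (mono_class V v (letters p N) S) f = 0 \<or> (\<Prod>x\<in>V - {v}. \<sigma> x (letter_gen (x \<in> S))) = 0"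
  shows "poly_eval (alg_mul k) \<sigma> V f = (\<lambda>_. 0)"
proof
  fix g
  have small: "poly_eval (alg_mul k) \<sigma> V f g = 0"
    if *: "\<And>v vs. length vs = N \<Longrightarrow> mon_eval (alg_mul k) \<sigma> (left_normed v vs) g = 0"
    unfolding poly_eval_def
  proof (rule sum.neutral, rule ballI)
    fix t assume t: "t \<in> mono_set V"
    show "f t * mon_eval (alg_mul k) \<sigma> t g = 0"
    proof (cases "\<exists>v vs. t = left_normed v vs")
      case True
      then obtain v vs where vs: "t = left_normed v vs" by blast
      then have d: "distinct (v # vs)" "set (v # vs) = V" using t by (auto simp: mono_set_def)
      then have "length vs = N" using V distinct_card[OF d(1)] by simp
      then show ?thesis using * vs by simp
    next
      case False
      then show ?thesis using mon_eval_not_left_normed[of \<sigma> t, OF \<sigma>] by simp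
    qed
  qed
  consider "g \<notin> range (zpos k)" | q where "g = zpos k q" "q < N" | p where "g = zpos k (p + N)"
    by (metis add.commute image_iff UNIV_I le_add_diff_inverse not_le)
  then show "poly_eval (alg_mul k) \<sigma> V f g = 0"
  proof cases
    case 1
    then show ?thesis using V by (intro small mon_eval_left_normed_nonbasis \<sigma>) auto
  next
    case 2
    show ?thesis unfolding 2(1) by (rule small[unfolded 2(1)], rule mon_eval_left_normed_less[OF \<sigma>]) (use 2 in simp)
  next
    case 3
    have "coeff_sum (mono_class V v (letters p N) S) f * (\<sigma> v (zpos k p) * (\<Prod>x\<in>V - {v}. \<sigma> x (letter_gen (x \<in> S)))) = 0"
      if "v \<in> V" "S \<in> Pow (V - {v})" for v S
    proof (cases "mono_class V v (letters p N) S = {}")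
      case True
      then show ?thesis by (simp add: coeff_sum_def)
    next
      case False
      then show ?thesis using zero[of v S p] that by auto
    qed
    then show ?thesis unfolding 3 poly_eval_zpos[OF \<sigma> V(1,2)] by (intro sum.neutral ballI)
  qed
qed

lemma delta_in_carrier: "e \<in> basis_set k \<Longrightarrow> delta e \<in> alg_carrier k"
  by (auto simp: alg_carrier_def supp_def delta_def)

text \<open>The test substitution that walks along the line from z_1^(1) and isolates a single
  coefficient sum. T need not lie inside V: with T the set of all odd variables the substitution
  respects the grading on every variable, including those outside V.\<close>

definition path_subst :: "'v \<Rightarrow> 'v set \<Rightarrow> 'v \<Rightarrow> gen \<Rightarrow> 'a::field" where
  "path_subst v T x = (if x = v then delta (zpos k 0) else delta (letter_gen (x \<in> T)))"

lemma path_subst_in_carrier: "path_subst v T x \<in> alg_carrier k"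
  unfolding path_subst_def
  by (auto intro!: delta_in_carrier simp: letter_gen_def basis_set_eq)

lemma poly_eval_path_subst:
  fixes f :: "'v mtree \<Rightarrow> 'a::field"
  assumes V: "finite V" "card V = Suc N" and v: "v \<in> V"
  shows "poly_eval (alg_mul k) (path_subst v T) V f (zpos k N)
    = coeff_sum (mono_class V v (letters 0 N) (T \<inter> (V - {v}))) f"
proof -
  have "poly_eval (alg_mul k) (path_subst v T) V f (zpos k N)
      = (\<Sum>v'\<in>V. \<Sum>S\<in>Pow (V - {v'}). if v' = v then
           if S = T \<inter> (V - {v}) then coeff_sum (mono_class V v (letters 0 N) (T \<inter> (V - {v}))) f else 0 else 0)"
    unfolding poly_eval_zpos[where p = 0, unfolded add_0, OF path_subst_in_carrier V]
  proof (intro sum.cong refl)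
    fix v' S assume v': "v' \<in> V" and S: "S \<in> Pow (V - {v'})"
    have v0: "path_subst v T v' (zpos k 0) = (if v' = v then 1 else 0 :: 'a)"
      by (auto simp: path_subst_def delta_def letter_gen_def)
    have "(\<Prod>x\<in>V - {v}. path_subst v T x (letter_gen (x \<in> S))) = (if S = T \<inter> (V - {v}) then 1 else 0 :: 'a)" if "S \<subseteq> V - {v}"
    proof (cases "S = T \<inter> (V - {v})")
      case True
      have "path_subst v T x (letter_gen (x \<in> S)) = (1 :: 'a)" if "x \<in> V - {v}" for x
        using that True by (auto simp: path_subst_def delta_def)
      then show ?thesis using True by simp
    next
      case False
      then obtain x where x: "x \<in> V - {v}" "x \<in> S \<longleftrightarrow> x \<notin> T" using \<open>S \<subseteq> V - {v}\<close> by auto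
      then have "path_subst v T x (letter_gen (x \<in> S)) = (0 :: 'a)"
        by (auto simp: path_subst_def delta_def letter_gen_def)
      then have "(\<Prod>x\<in>V - {v}. path_subst v T x (letter_gen (x \<in> S))) = (0 :: 'a)"
        using V x(1) by (intro prod_zero) blast+
      then show ?thesis using False by simp
    qed
    then show "coeff_sum (mono_class V v' (letters 0 N) S) f *
        (path_subst v T v' (zpos k 0) * (\<Prod>x\<in>V - {v'}. path_subst v T x (letter_gen (x \<in> S))))
      = (if v' = v then
           if S = T \<inter> (V - {v}) then coeff_sum (mono_class V v (letters 0 N) (T \<inter> (V - {v}))) f else 0 else 0)"
      using v0 S by (cases "v' = v") simp_all
  qed
  also have "\<dots> = (\<Sum>v'\<in>V. if v' = v then coeff_sum (mono_class V v (letters 0 N) (T \<inter> (V - {v}))) f else 0)"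
  proof (rule sum.cong[OF refl])
    fix v' assume "v' \<in> V"
    have "T \<inter> (V - {v}) \<in> Pow (V - {v})" by auto
    then show "(\<Sum>S\<in>Pow (V - {v'}). if v' = v then
           if S = T \<inter> (V - {v}) then coeff_sum (mono_class V v (letters 0 N) (T \<inter> (V - {v}))) f else 0 else 0)
        = (if v' = v then coeff_sum (mono_class V v (letters 0 N) (T \<inter> (V - {v}))) f else 0)"
      using V by (cases "v' = v") simp_all
  qed
  also have "\<dots> = coeff_sum (mono_class V v (letters 0 N) (T \<inter> (V - {v}))) f"
    using V v by simp
  finally show ?thesis .
qed

end

section \<open>Growth of binomial coefficients\<close>

definition entropy :: "real \<Rightarrow> real" where
  "entropy x = - x * ln x - (1 - x) * ln (1 - x)"

lemma Phi_eq_exp_entropy: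
  assumes "0 < x" "x < 1"
  shows "Phi x = exp (entropy x)"
  using assms by (simp add: Phi_def entropy_def powr_def algebra_simps flip: exp_add)

text \<open>One term of the expansion of (x + (1 - x))^n is at most 1. Replacing d by n x in the
  exponent costs (d - n x) (ln (1 - x) - ln x); for x at most 1/2 the second factor is nonnegative,
  so D bounds the cost.\<close>

lemma binomial_le_exp_entropy:
  assumes x: "0 < x" "x \<le> 1 / 2" and d: "d \<le> n" "\<bar>real d - real n * x\<bar> \<le> D"
  shows "real (n choose d) \<le> exp (real n * entropy x + D * (ln (1 - x) - ln x))"
proof -
  have "real (n choose d) * x ^ d * (1 - x) ^ (n - d) \<le> (\<Sum>k\<le>n. real (n choose k) * x ^ k * (1 - x) ^ (n - k))"
    using x d by (intro member_le_sum) auto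
  also have "\<dots> = 1" using binomial_ring[of x "1 - x" n] by simp
  finally have 1: "real (n choose d) * (x ^ d * (1 - x) ^ (n - d)) \<le> 1" by (simp add: mult.assoc)
  have "x ^ d * (1 - x) ^ (n - d) = exp (real d * ln x) * exp (real (n - d) * ln (1 - x))"
    using x by (simp add: exp_of_nat_mult)
  also have "\<dots> = exp (- (real n * entropy x + (real d - real n * x) * (ln (1 - x) - ln x)))"
    using d by (simp add: entropy_def of_nat_diff algebra_simps flip: exp_add)
  finally have "real (n choose d) * exp (- (real n * entropy x + (real d - real n * x) * (ln (1 - x) - ln x))) \<le> 1"
    using 1 by simp
  then have "real (n choose d) \<le> exp (real n * entropy x + (real d - real n * x) * (ln (1 - x) - ln x))"
    by (simp only: exp_minus) (simp add: field_simps)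
  also have "\<dots> \<le> exp (real n * entropy x + D * (ln (1 - x) - ln x))"
  proof -
    have "(real d - real n * x) * (ln (1 - x) - ln x) \<le> D * (ln (1 - x) - ln x)"
      using x d by (intro mult_right_mono) auto
    then show ?thesis by simp
  qed
  finally show ?thesis .
qed

text \<open>Stirling's formula up to the factor e n. In the induction step ln t \<le> t - 1 is
  applied at t = n / (n + 1) for the upper bound and at t = (n + 1) / n for the lower one.\<close>

lemma ln_fact_bounds:
  assumes "n \<ge> 1"
  shows "real n * ln n - n \<le> ln (fact n)" "ln (fact n) \<le> 1 + ln n + real n * ln n - n"
proof -
  have "real n * ln n - n \<le> ln (fact n) \<and> ln (fact n) \<le> 1 + ln n + real n * ln n - n"
    using assms
  proof (induction n rule: dec_induct)
    case base
    then show ?case by simp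
  next
    case (step n)
    then have n: "real n > 0" by simp
    have f: "ln (fact (Suc n) :: real) = ln (1 + real n) + ln (fact n)"
      by (simp add: ln_mult)
    have "ln (real n / (1 + real n)) \<le> real n / (1 + real n) - 1"
      using n by (intro ln_le_minus_one) auto
    then have "ln (real n) - ln (1 + real n) \<le> - 1 / (1 + real n)"
      using n by (simp add: ln_div field_simps)
    then have "(1 + real n) * (ln (real n) - ln (1 + real n)) \<le> (1 + real n) * (- 1 / (1 + real n))"
      by (intro mult_left_mono) auto
    then have 1: "(1 + real n) * (ln (real n) - ln (1 + real n)) \<le> - 1" using n by simp
    have "ln ((1 + real n) / real n) \<le> (1 + real n) / real n - 1"
      using n by (intro ln_le_minus_one) auto
    then have "ln (1 + real n) - ln (real n) \<le> 1 / real n"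
      using n by (simp add: ln_div field_simps)
    then have "real n * (ln (1 + real n) - ln (real n)) \<le> real n * (1 / real n)"
      by (intro mult_left_mono) auto
    then have 2: "real n * (ln (1 + real n) - ln (real n)) \<le> 1" using n by simp
    show ?case using step.IH 1 2 unfolding f by (simp add: algebra_simps)
  qed
  then show "real n * ln n - n \<le> ln (fact n)" "ln (fact n) \<le> 1 + ln n + real n * ln n - n" by auto
qed

text \<open>The linear terms of Stirling's bounds cancel since d + (n - d) = n. The two factorials
  in the denominator each lose 1 + ln n, which gives the constant 2 + 2 ln n.\<close>

lemma binomial_ge_exp_entropy:
  assumes d: "0 < d" "d < n"
  shows "exp (real n * entropy (real d / real n) - 2 - 2 * ln n) \<le> real (n choose d)"
proof -
  have pos: "real (n choose d) > 0" using d by simp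
  have "real (n choose d) = fact n / (fact d * fact (n - d))" using d by (simp add: binomial_fact)
  then have "ln (real (n choose d)) = ln (fact n) - (ln (fact d) + ln (fact (n - d)))"
    by (simp add: ln_div ln_mult)
  moreover have "real n * ln n - n \<le> ln (fact n)" using d by (intro ln_fact_bounds) auto
  moreover have "ln (fact d) \<le> 1 + ln d + real d * ln d - d" using d by (intro ln_fact_bounds) auto
  moreover have "ln (fact (n - d)) \<le> 1 + ln (real (n - d)) + real (n - d) * ln (real (n - d)) - real (n - d)"
    using d by (intro ln_fact_bounds) auto
  moreover have "ln (real d) \<le> ln (real n)" "ln (real (n - d)) \<le> ln (real n)" using d by auto
  moreover have "1 - real d / real n = real (n - d) / real n" using d by (simp add: field_simps of_nat_diff)
  then have "real n * entropy (real d / real n) = real n * ln n - real d * ln d - real (n - d) * ln (real (n - d))"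
    using d unfolding entropy_def by (simp add: ln_div field_simps of_nat_diff)
  moreover have "real (n - d) = real n - real d" using d by (simp add: of_nat_diff)
  ultimately have "real n * entropy (real d / real n) - 2 - 2 * ln n \<le> ln (real (n choose d))"
    by linarith
  then show ?thesis using pos by (metis exp_le_cancel_iff exp_ln)
qed

section \<open>Limits of n-th roots\<close>

lemma root_exp_sandwich:
  fixes c :: "nat \<Rightarrow> nat"
  assumes "eventually (\<lambda>n. exp (y n) \<le> real (c n)) sequentially"
    and "eventually (\<lambda>n. real (c n) \<le> exp (z n)) sequentially"
    and "(\<lambda>n. y n / real n) \<longlonglongrightarrow> h" "(\<lambda>n. z n / real n) \<longlonglongrightarrow> h"
  shows "(\<lambda>n. root n (real (c n))) \<longlonglongrightarrow> exp h"
proof (rule tendsto_sandwich)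
  have root_exp: "root n (exp t) = exp (t / real n)" if "n > 0" for n t
  proof -
    have "exp t = exp (t / real n) ^ n" using that by (simp flip: exp_of_nat_mult)
    then show ?thesis using that by (simp add: real_root_power_cancel)
  qed
  show "eventually (\<lambda>n. exp (y n / real n) \<le> root n (real (c n))) sequentially"
    using assms(1) eventually_gt_at_top[of 0]
    by eventually_elim (simp flip: root_exp)
  show "eventually (\<lambda>n. root n (real (c n)) \<le> exp (z n / real n)) sequentially"
    using assms(2) eventually_gt_at_top[of 0]
    by eventually_elim (simp flip: root_exp)
qed (use assms(3,4) in \<open>auto intro: tendsto_exp\<close>)

text \<open>Stated for an arbitrary sequence c so that it serves both codimensions. The cube covers
  three linear factors: the choice of the first variable, the number of factors of the word, and the
  number of summands of the graded codimension. Under the n-th root it contributes only O(ln n /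
  n).\<close>

lemma root_limit:
  fixes c q :: "nat \<Rightarrow> nat"
  assumes x: "0 < x" "x \<le> 1 / 2"
    and q: "\<And>n. \<bar>real (q n) - real n * x\<bar> \<le> D"
    and lower: "\<And>n. n \<ge> 2 \<Longrightarrow> (n - 1) choose q n \<le> c n"
    and upper: "\<And>n B. n \<ge> 2 \<Longrightarrow> (\<And>d. d \<le> n \<Longrightarrow> \<bar>real d - real n * x\<bar> \<le> D \<Longrightarrow> real (n choose d) \<le> B)
      \<Longrightarrow> B \<ge> 0 \<Longrightarrow> real (c n) \<le> C * (real n + A) ^ 3 * B"
    and C: "C > 0" and A: "A > 0"
  shows "(\<lambda>n. root n (real (c n))) \<longlonglongrightarrow> Phi x"
proof -
  have qlim: "(\<lambda>n. real (q n) / real (n - 1)) \<longlonglongrightarrow> x"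
  proof (rule tendsto_sandwich)
    show "(\<lambda>n. (real n * x - D) / (real n - 1)) \<longlonglongrightarrow> x" by real_asymp
    show "(\<lambda>n. (real n * x + D) / (real n - 1)) \<longlonglongrightarrow> x" by real_asymp
    have le: "real n * x - D \<le> real (q n)" "real (q n) \<le> real n * x + D" for n
      using q[of n] by (auto simp: abs_le_iff)
    show "eventually (\<lambda>n. (real n * x - D) / (real n - 1) \<le> real (q n) / real (n - 1)) sequentially"
      using eventually_gt_at_top[of 1]
      by eventually_elim (use le in \<open>auto simp: of_nat_diff intro!: divide_right_mono\<close>)
    show "eventually (\<lambda>n. real (q n) / real (n - 1) \<le> (real n * x + D) / (real n - 1)) sequentially"
      using eventually_gt_at_top[of 1]
      by eventually_elim (use le in \<open>auto simp: of_nat_diff intro!: divide_right_mono\<close>)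
  qed
  have less_one: "x < 1" using x by simp
  \<comment> \<open>The lower entropy bound needs 0 < d < n; this holds eventually because the limit
    x lies strictly between 0 and 1.\<close>
  have ev: "eventually (\<lambda>n. 0 < q n \<and> q n < n - 1) sequentially"
    using order_tendstoD(1)[OF qlim x(1)] order_tendstoD(2)[OF qlim less_one] eventually_gt_at_top[of 1]
    by eventually_elim (auto simp: zero_less_divide_iff divide_less_eq)
  define y where "y n = real (n - 1) * entropy (real (q n) / real (n - 1)) - 2 - 2 * ln (real (n - 1))" for n
  define z where "z n = ln C + 3 * ln (real n + A) + (real n * entropy x + D * (ln (1 - x) - ln x))" for n
  have "(\<lambda>n. root n (real (c n))) \<longlonglongrightarrow> exp (entropy x)"
  proof (rule root_exp_sandwich)
    show "eventually (\<lambda>n. exp (y n) \<le> real (c n)) sequentially"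
      using ev eventually_ge_at_top[of 2]
    proof eventually_elim
      case (elim n)
      have "exp (y n) \<le> real ((n - 1) choose q n)"
        unfolding y_def using elim by (intro binomial_ge_exp_entropy) auto
      also have "\<dots> \<le> real (c n)" using lower elim by simp
      finally show ?case .
    qed
    show "eventually (\<lambda>n. real (c n) \<le> exp (z n)) sequentially"
      using eventually_ge_at_top[of 2]
    proof eventually_elim
      case (elim n)
      have "real (c n) \<le> C * (real n + A) ^ 3 * exp (real n * entropy x + D * (ln (1 - x) - ln x))"
        using elim by (intro upper binomial_le_exp_entropy x) auto
      also have "C * (real n + A) ^ 3 = exp (ln C + 3 * ln (real n + A))"
        using C A exp_of_nat_mult[of 3 "ln (real n + A)"] by (simp add: exp_add add_nonneg_pos)
      finally show ?case by (simp add: z_def flip: exp_add)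
    qed
    have "isCont entropy x" unfolding entropy_def using x by (intro continuous_intros) auto
    then have "(\<lambda>n. entropy (real (q n) / real (n - 1))) \<longlonglongrightarrow> entropy x"
      using qlim by (rule isCont_tendsto_compose)
    moreover have "(\<lambda>n. real (n - 1) / real n) \<longlonglongrightarrow> 1" "(\<lambda>n. (2 + 2 * ln (real (n - 1))) / real n) \<longlonglongrightarrow> 0"
      by real_asymp+
    ultimately have "(\<lambda>n. real (n - 1) / real n * entropy (real (q n) / real (n - 1)) - (2 + 2 * ln (real (n - 1))) / real n)
        \<longlonglongrightarrow> 1 * entropy x - 0"
      by (intro tendsto_intros)
    then show "(\<lambda>n. y n / real n) \<longlonglongrightarrow> entropy x"
      by (simp add: y_def diff_divide_distrib add_divide_distrib diff_diff_eq)
    show "(\<lambda>n. z n / real n) \<longlonglongrightarrow> entropy x"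
      unfolding z_def by real_asymp
  qed
  then show ?thesis using x by (simp add: Phi_eq_exp_entropy)
qed

section \<open>Codimension bounds\<close>

context block_lengths
begin

definition letter_words :: "nat \<Rightarrow> bool list set" where
  "letter_words N = range (\<lambda>p. letters p N)"

lemma length_letters [simp]: "length (letters p N) = N"
  by (simp add: letters_def)

lemma letters_in [simp]: "letters p N \<in> letter_words N"
  by (simp add: letter_words_def)

lemma finite_letter_words: "finite (letter_words N)"
proof (rule finite_subset)
  show "letter_words N \<subseteq> {u. set u \<subseteq> UNIV \<and> length u = N}" by (auto simp: letter_words_def)
qed (rule finite_lists_length_eq, simp)

lemma b_step_iff: "b_step k p \<longleftrightarrow> \<not> snd (state k p) < k (fst (state k p))"
  using state_bounds[of p] by (auto simp: b_step_fst_snd)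

text \<open>The block index advances exactly at a letter b, so counting letters b in a window
  amounts to counting finished blocks.\<close>

lemma block_index_add: "fst (state k (p + N)) = fst (state k p) + length (filter id (letters p N))"
proof (induction N)
  case (Suc N)
  have "letters p (Suc N) = letters p N @ [b_step k (p + N)]" by (simp add: letters_def)
  then show ?case using Suc unfolding add_Suc_right state_Suc_b_step by (simp add: b_step_iff)
qed (simp add: letters_def)

lemma state_position: "Suc p = (\<Sum>l\<in>{1..<fst (state k p)}. k l) + snd (state k p)"
proof (induction p)
  case (Suc p)
  show ?case
  proof (cases "b_step k p")
    case True
    then show ?thesis
      using Suc state_bounds[of p] unfolding state_Suc_b_step b_step_fst_snd by simp
  next
    case False
    then show ?thesis using Suc unfolding state_Suc_b_step b_step_iff by simp
  qed
qed simp

text \<open>Common source of both upper bounds. \<open>Sel v u\<close> collects the sets S whose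
  class can have a nonzero value: all sets of the right size without grading, at most one set with
  it.\<close>

lemma codim_le_letter_words:
  fixes SS :: "('v \<Rightarrow> gen \<Rightarrow> 'a::field) set"
  assumes V: "finite V" "card V = Suc N" "N > 0"
    and SS: "\<And>\<sigma> v. \<sigma> \<in> SS \<Longrightarrow> \<sigma> v \<in> alg_carrier k"
    and Sel: "\<And>v u. v \<in> V \<Longrightarrow> u \<in> letter_words N \<Longrightarrow> Sel v u \<subseteq> Pow (V - {v}) \<and> real (card (Sel v u)) \<le> B"
    and out: "\<And>\<sigma> v u S. \<sigma> \<in> SS \<Longrightarrow> v \<in> V \<Longrightarrow> u \<in> letter_words N \<Longrightarrow> S \<subseteq> V - {v} \<Longrightarrow>
      card S = length (filter id u) \<Longrightarrow> S \<notin> Sel v u \<Longrightarrow> \<exists>x\<in>V - {v}. \<sigma> x (letter_gen (x \<in> S)) = 0"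
  shows "real (codim (alg_mul k) SS V TYPE('v mtree \<Rightarrow> 'a)) \<le> real (card V * card (letter_words N)) * B"
proof -
  let ?\<M> = "\<Union>(v, u)\<in>V \<times> letter_words N. mono_class V v u ` Sel v u"
  have finSel: "finite (Sel v u)" if "v \<in> V" "u \<in> letter_words N" for v u
    using Sel[OF that] V by (meson finite_Diff finite_Pow_iff finite_subset)
  have "codim (alg_mul k) SS V TYPE('v mtree \<Rightarrow> 'a) \<le> card ?\<M>"
  proof (rule codim_le)
    show "finite ?\<M>" using finSel V finite_letter_words by auto
    fix f :: "'v mtree \<Rightarrow> 'a" assume f: "f \<in> coeff_kers V ?\<M>"
    have "poly_eval (alg_mul k) \<sigma> V f = (\<lambda>_. 0)" if \<sigma>: "\<sigma> \<in> SS" for \<sigma>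
    proof (rule poly_eval_vanishes[OF _ V])
      fix p v S assume v: "v \<in> V" and S: "S \<subseteq> V - {v}" and ne: "mono_class V v (letters p N) S \<noteq> {}"
      have c: "card S = length (filter id (letters p N))" by (rule card_mono_class[OF S ne])
      show "coeff_sum (mono_class V v (letters p N) S) f = 0 \<or> (\<Prod>x\<in>V - {v}. \<sigma> x (letter_gen (x \<in> S))) = 0"
      proof (cases "S \<in> Sel v (letters p N)")
        case True
        then have "mono_class V v (letters p N) S \<in> ?\<M>"
          by (intro UN_I[of "(v, letters p N)"]) (auto simp: v)
        then show ?thesis using f by (auto simp: coeff_kers_def)
      next
        case False
        then have "\<exists>x\<in>V - {v}. \<sigma> x (letter_gen (x \<in> S)) = 0" using out[OF \<sigma> v _ S c] by simp
        then show ?thesis using V by (intro disjI2 prod_zero) auto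
      qed
    qed (use SS \<sigma> in auto)
    then show "f \<in> ident_part (alg_mul k) SS V" using f by (simp add: ident_part_def coeff_kers_def)
  qed (use V in auto)
  also have "card ?\<M> \<le> (\<Sum>(v, u)\<in>V \<times> letter_words N. card (mono_class V v u ` Sel v u))"
    using card_UN_le[of "V \<times> letter_words N" "\<lambda>(v, u). mono_class V v u ` Sel v u"] V finite_letter_words
    by (simp add: split_def)
  also have "\<dots> \<le> (\<Sum>(v, u)\<in>V \<times> letter_words N. card (Sel v u))"
    by (intro sum_mono) (auto intro!: card_image_le finSel)
  finally have "real (codim (alg_mul k) SS V TYPE('v mtree \<Rightarrow> 'a)) \<le> (\<Sum>(v, u)\<in>V \<times> letter_words N. real (card (Sel v u)))"
    by (simp add: split_def flip: of_nat_sum)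
  also have "\<dots> \<le> (\<Sum>(v, u)\<in>V \<times> letter_words N. B)"
    using Sel by (intro sum_mono) auto
  also have "\<dots> = real (card V * card (letter_words N)) * B"
    by (simp add: split_def card_cartesian_product)
  finally show ?thesis .
qed

text \<open>One first variable and the walk from position 0 already suffice for the lower bound:
  classes with different S are disjoint and nonempty, and a test substitution forces each
  coefficient sum of an identity to be 0.\<close>

lemma codim_ge_path_subst:
  fixes SS :: "('v \<Rightarrow> gen \<Rightarrow> 'a::field) set"
  assumes V: "finite V" "card V = Suc N" "v \<in> V"
    and Sel: "\<And>S. S \<in> Sel \<Longrightarrow> S \<subseteq> V - {v} \<and> card S = length (filter id (letters 0 N))"
    and inSS: "\<And>S. S \<in> Sel \<Longrightarrow> \<exists>T. T \<inter> (V - {v}) = S \<and> path_subst v T \<in> SS"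
  shows "card Sel \<le> codim (alg_mul k) SS V TYPE('v mtree \<Rightarrow> 'a)"
proof -
  let ?c = "mono_class V v (letters 0 N)"
  have ne: "?c S \<noteq> {}" if "S \<in> Sel" for S
    using mono_class_nonempty[of V v S "letters 0 N"] V Sel[OF that] by simp
  have dj: "S = S'" if "S \<in> Sel" "S' \<in> Sel" "?c S \<inter> ?c S' \<noteq> {}" for S S'
    using mono_class_disjoint(2)[of S V v S' v] Sel that by blast
  have fin: "finite Sel"
    by (rule finite_subset[of _ "Pow (V - {v})"]) (use Sel V in auto)
  have "inj_on ?c Sel" using ne dj by (intro inj_onI) (metis Int_absorb)
  then have "card Sel = card (?c ` Sel)" by (simp add: card_image)
  also have "\<dots> \<le> codim (alg_mul k) SS V TYPE('v mtree \<Rightarrow> 'a)"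
  proof (rule codim_ge)
    show "M \<noteq> {} \<and> M \<subseteq> mono_set V" if M: "M \<in> ?c ` Sel" for M
    proof -
      obtain S where "S \<in> Sel" "M = ?c S" using M by blast
      then show ?thesis using ne[of S] by (simp add: mono_class_subset)
    qed
    show "M \<inter> M' = {}" if "M \<in> ?c ` Sel" "M' \<in> ?c ` Sel" "M \<noteq> M'" for M M'
      using that dj by blast
    fix f :: "'v mtree \<Rightarrow> 'a" assume f: "f \<in> ident_part (alg_mul k) SS V"
    have "coeff_sum (?c S) f = 0" if S: "S \<in> Sel" for S
    proof -
      obtain T where T: "T \<inter> (V - {v}) = S" "path_subst v T \<in> SS" using inSS[OF S] by blast
      have "poly_eval (alg_mul k) (path_subst v T) V f (zpos k N) = 0"
        using f T by (simp add: ident_part_def)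
      then show ?thesis using poly_eval_path_subst[OF V, of T f] T(1) by simp
    qed
    then show "f \<in> coeff_kers V (?c ` Sel)" using f by (auto simp: coeff_kers_def ident_part_def)
  qed (use V fin in auto)
  finally show ?thesis .
qed

end

lemma card_range_le:
  assumes "finite (range g)" "\<And>x y. g x = g y \<Longrightarrow> f x = f y"
  shows "card (range f) \<le> card (range g)"
proof -
  have "range f \<subseteq> (\<lambda>y. f (SOME x. g x = y)) ` range g"
  proof
    fix z assume "z \<in> range f"
    then obtain x where x: "z = f x" by blast
    have "g (SOME x'. g x' = g x) = g x" by (rule someI) simp
    then have "f (SOME x'. g x' = g x) = f x" by (rule assms(2))
    then show "z \<in> (\<lambda>y. f (SOME x. g x = y)) ` range g" using x by (metis image_eqI rangeI)
  qed
  then show ?thesis using assms(1) by (metis card_image_le card_mono finite_imageI le_trans)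
qed

section \<open>Letter counts and number of factors for A(m,w)\<close>

locale balanced_word_algebra =
  fixes m :: nat and w :: "nat \<Rightarrow> nat" and \<alpha> :: real and C :: nat
  assumes m: "m \<ge> 2" and w: "binary_word w" and slope: "has_slope w \<alpha>"
    and bal: "\<And>i j n. wsum w i n \<le> wsum w j n + C"
    and compl: "\<And>n. complexity w n \<le> n + C"
begin

abbreviation "K \<equiv> kmw m w"

text \<open>The limiting frequency of the letter b: one b per block, with average block length m +
  \<alpha>.\<close>

definition \<theta> :: real where "\<theta> = 1 / (real m + \<alpha>)"

sublocale block_lengths "kmw m w"
  by unfold_locales (use m in \<open>simp add: kmw_def\<close>)

text \<open>The bound 1/2, required by \<open>binomial_le_exp_entropy\<close>, comes from m \<ge> 2
  and \<alpha> \<ge> 0.\<close>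

lemma \<theta>_bounds: "0 < \<theta>" "\<theta> \<le> 1 / 2"
  using has_slope_bounds[OF w slope] m by (auto simp: \<theta>_def field_simps)

lemma K_le: "K i \<le> m + 1"
  using binary_cases[OF w, of "i - 1"] by (auto simp: kmw_def)

lemma state_snd: "1 \<le> snd (state K p)" "snd (state K p) \<le> m + 1"
  using state_bounds[of p] K_le[of "fst (state K p)"] by auto

text \<open>A window with d letters b passes d block ends, so N equals m d plus the weight of d
  consecutive letters of w, up to the difference of two positions inside blocks. These positions lie
  between 1 and m + 1, which gives the error m; replacing the weight by d \<alpha> gives the error
  C. Multiplying by \<open>\<theta>\<close> < 1 does not enlarge the sum.\<close>

lemma letter_count:
  "\<bar>real (length (filter id (letters p N))) - real N * \<theta>\<bar> \<le> real (m + C)"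
proof -
  let ?d = "length (filter id (letters p N))" and ?I = "fst (state K p)"
  \<comment> \<open>Blocks are numbered from 1 but the word from 0, hence the shift by one.\<close>
  let ?s = "wsum w (?I - 1) ?d"
  have I: "1 \<le> ?I" using state_bounds[of p] by simp
  have "(\<Sum>l\<in>{1..<?I + ?d}. K l) = (\<Sum>l\<in>{1..<?I}. K l) + (\<Sum>l\<in>{?I..<?I + ?d}. K l)"
    using I by (simp add: sum.atLeastLessThan_concat)
  also have "(\<Sum>l\<in>{?I..<?I + ?d}. K l) = (\<Sum>l<?d. K (?I + l))"
    using sum.shift_bounds_nat_ivl[of K 0 ?I ?d] by (simp add: atLeast0LessThan add.commute)
  also have "\<dots> = (\<Sum>l<?d. m + w (?I - 1 + l))"
    using I by (intro sum.cong) (auto simp: kmw_def)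
  also have "\<dots> = m * ?d + ?s" by (simp add: sum.distrib wsum_def)
  finally have "N + snd (state K p) = m * ?d + ?s + snd (state K (p + N))"
    using state_position[of p] state_position[of "p + N"] unfolding block_index_add by linarith
  then have "real N + real (snd (state K p)) = real m * real ?d + real ?s + real (snd (state K (p + N)))"
    by (metis of_nat_add of_nat_mult)
  moreover have "1 \<le> real (snd (state K q))" "real (snd (state K q)) \<le> real m + 1" for q
    using state_snd[of q] by linarith+
  note this[of p] this[of "p + N"]
  moreover have "\<bar>real ?s - real ?d * \<alpha>\<bar> \<le> real C" by (rule balanced_slope[OF slope bal])
  ultimately have 1: "\<bar>real ?d * (real m + \<alpha>) - real N\<bar> \<le> real (m + C)"
    unfolding distrib_left by (simp add: mult.commute)
  have "real ?d - real N * \<theta> = (real ?d * (real m + \<alpha>) - real N) * \<theta>"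
    using has_slope_bounds[OF w slope] m by (simp add: \<theta>_def field_simps)
  then have "\<bar>real ?d - real N * \<theta>\<bar> = \<bar>real ?d * (real m + \<alpha>) - real N\<bar> * \<theta>"
    using \<theta>_bounds by (simp add: abs_mult)
  also have "\<dots> \<le> real (m + C) * 1" using 1 \<theta>_bounds by (intro mult_mono) auto
  finally show ?thesis by simp
qed

text \<open>The next N letters are determined by the place inside the current block and the lengths
  of at most N blocks from there on. With at most m + 1 places and linear complexity of w, this
  bounds the number of factors over a and b linearly.\<close>

lemma letters_eqI:
  assumes s: "snd (state K p) = snd (state K p')"
    and f: "factor_at w N (fst (state K p) - 1) = factor_at w N (fst (state K p') - 1)"
  shows "letters p N = letters p' N"
proof -
  let ?I = "fst (state K p)" and ?I' = "fst (state K p')"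
  have I: "1 \<le> ?I" "1 \<le> ?I'" using state_bounds by blast+
  have Keq: "K (?I + e) = K (?I' + e)" if "e < N" for e
    using f that I unfolding factor_at_eq_iff by (auto simp: kmw_def)
  \<comment> \<open>After t steps both walks stand at the same place inside a block and have passed
    the same number e of block ends.\<close>
  have *: "snd (state K (p + t)) = snd (state K (p' + t)) \<and>
      (\<exists>e\<le>t. fst (state K (p + t)) = ?I + e \<and> fst (state K (p' + t)) = ?I' + e)" if "t \<le> N" for t
    using that
  proof (induction t)
    case 0
    then show ?case using s by simp
  next
    case (Suc t)
    then obtain e where e: "e \<le> t" "snd (state K (p + t)) = snd (state K (p' + t))"
      "fst (state K (p + t)) = ?I + e" "fst (state K (p' + t)) = ?I' + e" by auto
    moreover have "K (?I + e) = K (?I' + e)" using e Suc.prems by (intro Keq) auto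
    ultimately show ?case
      unfolding add_Suc_right state_Suc_b_step
      by (cases "snd (state K (p + t)) < K (?I + e)") (auto intro: exI[of _ e] exI[of _ "Suc e"])
  qed
  have "b_step K (p + t) = b_step K (p' + t)" if "t < N" for t
    using *[of t] Keq that by (auto simp: b_step_fst_snd)
  then show ?thesis by (simp add: letters_def)
qed

lemma card_letter_words: "card (letter_words N) \<le> (m + 1) * (N + C)"
proof -
  let ?g = "\<lambda>p. (snd (state K p), factor_at w N (fst (state K p) - 1))"
  have sub: "range ?g \<subseteq> {1..m + 1} \<times> subwords w N"
    using state_snd by (auto simp: factor_at_in)
  have fin: "finite ({1..m + 1} \<times> subwords w N)" using finite_subwords[OF w] by simp
  have "card (letter_words N) \<le> card (range ?g)"
    unfolding letter_words_def
    using finite_subset[OF sub fin] by (rule card_range_le) (auto intro: letters_eqI)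
  also have "\<dots> \<le> card ({1..m + 1} \<times> subwords w N)" by (rule card_mono[OF fin sub])
  also have "\<dots> = (m + 1) * complexity w N" by (simp add: card_cartesian_product complexity_def)
  also have "\<dots> \<le> (m + 1) * (N + C)" using compl by (intro mult_le_mono) auto
  finally show ?thesis .
qed

text \<open>To the error m + C of \<open>letter_count\<close>, 1 is added for a count that may be
  off by one because of the first variable, and 1 for passing from N to n = N + 1, which costs
  \<open>\<theta>\<close>.\<close>

definition "letter_dev = real (m + C) + 2"

lemma letter_count_shift:
  assumes "d = length (filter id u)" "u \<in> letter_words N" "n = Suc N" "\<bar>real d' - real d\<bar> \<le> 1"
  shows "\<bar>real d' - real n * \<theta>\<bar> \<le> letter_dev"
proof -
  have "\<bar>real d - real N * \<theta>\<bar> \<le> real (m + C)"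
    using assms(1,2) letter_count by (auto simp: letter_words_def)
  then show ?thesis using assms(3,4) \<theta>_bounds by (auto simp: letter_dev_def algebra_simps abs_le_iff)
qed

lemma poly_bound:
  assumes "n = Suc N" "B \<ge> 0"
  shows "real (Suc n) * (real (n * card (letter_words N)) * B) \<le> real (m + 1) * (real n + (real C + 1)) ^ 3 * B"
proof -
  let ?x = "real n + (real C + 1)"
  have "real (card (letter_words N)) \<le> real ((m + 1) * (N + C))"
    using card_letter_words by (simp only: of_nat_le_iff)
  also have "\<dots> \<le> real (m + 1) * ?x"
    unfolding of_nat_mult using assms by (intro mult_left_mono) auto
  finally have "real n * real (card (letter_words N)) \<le> ?x * (real (m + 1) * ?x)"
    by (intro mult_mono) auto
  then have 1: "real (n * card (letter_words N)) * B \<le> ?x * (real (m + 1) * ?x) * B"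
    unfolding of_nat_mult by (rule mult_right_mono[OF _ assms(2)])
  have "real (Suc n) * (real (n * card (letter_words N)) * B) \<le> ?x * (?x * (real (m + 1) * ?x) * B)"
  proof (rule mult_mono[OF _ 1])
    show "0 \<le> real (n * card (letter_words N)) * B" using assms(2) by simp
  qed auto
  then show ?thesis
    by (simp add: power3_eq_cube mult_ac)
qed

text \<open>In degree n one variable takes the value at position 0, so only n - 1 letters are
  spelled out.\<close>

definition prefix_count :: "nat \<Rightarrow> nat" where "prefix_count n = length (filter id (letters 0 (n - 1)))"

lemma prefix_count_le: "prefix_count n \<le> n - 1"
  unfolding prefix_count_def by (metis length_filter_le length_letters)

lemma prefix_count_dev: "\<bar>real (prefix_count n) - real n * \<theta>\<bar> \<le> letter_dev"
proof (cases n)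
  case 0
  then show ?thesis by (simp add: prefix_count_def letters_def letter_dev_def)
next
  case (Suc N)
  then show ?thesis by (intro letter_count_shift[OF refl letters_in[of 0 N]]) (auto simp: prefix_count_def)
qed

lemma choose_mono_Suc: "N choose d \<le> Suc N choose d"
  by (cases d) auto

lemma cn_upper:
  assumes n: "n \<ge> 2" and B: "\<And>d. d \<le> n \<Longrightarrow> \<bar>real d - real n * \<theta>\<bar> \<le> letter_dev \<Longrightarrow> real (n choose d) \<le> B" "B \<ge> 0"
  shows "real (cn TYPE('a::field) m w n) \<le> real (m + 1) * (real n + (real C + 1)) ^ 3 * B"
proof -
  obtain N where N: "n = Suc N" "N > 0" using n by (cases n) auto
  have "real (cn TYPE('a) m w n) \<le> real (card {..<n} * card (letter_words N)) * B"
    unfolding cn_def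
  proof (rule codim_le_letter_words[where Sel = "\<lambda>v u. {S. S \<subseteq> {..<n} - {v} \<and> card S = length (filter id u)}"])
    fix v u assume v: "v \<in> {..<n}" and u: "u \<in> letter_words N"
    let ?d = "length (filter id u)"
    have "length u = N" using u by (auto simp: letter_words_def)
    then have "?d \<le> N" using length_filter_le[of id u] by simp
    have "card {S. S \<subseteq> {..<n} - {v} \<and> card S = ?d} = N choose ?d"
      using v N by (subst n_subsets) auto
    also have "\<dots> \<le> n choose ?d" using N choose_mono_Suc by simp
    finally have "real (card {S. S \<subseteq> {..<n} - {v} \<and> card S = ?d}) \<le> real (n choose ?d)" by simp
    also have "\<dots> \<le> B"
      by (rule B(1)) (use \<open>?d \<le> N\<close> N u letter_count_shift[OF refl u N(1), of ?d] in auto)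
    finally show "{S. S \<subseteq> {..<n} - {v} \<and> card S = ?d} \<subseteq> Pow ({..<n} - {v})
        \<and> real (card {S. S \<subseteq> {..<n} - {v} \<and> card S = ?d}) \<le> B" by auto
  qed (use N in auto)
  \<comment> \<open>The factor n + 1 is given away here to reach the same bound as in the graded
    case.\<close>
  also have "\<dots> \<le> real (Suc n) * (real (n * card (letter_words N)) * B)"
    using B(2) by (simp add: algebra_simps)
  also have "\<dots> \<le> real (m + 1) * (real n + (real C + 1)) ^ 3 * B" by (rule poly_bound[OF N(1) B(2)])
  finally show ?thesis .
qed

lemma cn_lower:
  assumes "n \<ge> 2"
  shows "(n - 1) choose prefix_count n \<le> cn TYPE('a::field) m w n"
proof -
  let ?Sel = "{S. S \<subseteq> {..<n} - {0} \<and> card S = prefix_count n}"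
  have "(n - 1) choose prefix_count n = card ?Sel" using assms by (subst n_subsets) auto
  also have "\<dots> \<le> cn TYPE('a) m w n"
    unfolding cn_def
  proof (rule codim_ge_path_subst[where N = "n - 1" and v = 0])
    fix S assume S: "S \<in> ?Sel"
    show "\<exists>T. T \<inter> ({..<n} - {0}) = S \<and> path_subst 0 T \<in> {\<sigma>. \<forall>v. \<sigma> v \<in> (alg_carrier K :: (gen \<Rightarrow> 'a) set)}"
      using S by (intro exI[of _ S]) (auto simp: path_subst_in_carrier)
  qed (use assms in \<open>auto simp: prefix_count_def\<close>)
  finally show ?thesis .
qed

section \<open>Graded codimensions\<close>

abbreviation gr_substs :: "(nat + nat \<Rightarrow> gen \<Rightarrow> 'a::field) set" where
  "gr_substs \<equiv> {\<sigma>. \<forall>i. \<sigma> (Inl i) \<in> alg_even K \<and> \<sigma> (Inr i) \<in> alg_odd K}"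

abbreviation gr_vars :: "nat \<Rightarrow> nat \<Rightarrow> (nat + nat) set" where
  "gr_vars l n \<equiv> Inl ` {..<l} \<union> Inr ` {..<n - l}"

lemma card_gr_vars: "l \<le> n \<Longrightarrow> card (gr_vars l n) = n"
  by (subst card_Un_disjoint) (auto simp: card_image)

text \<open>The grading forces S to be the set of odd variables other than v, so each pair (v, u)
  contributes at most one class, and none if the sizes do not match. The conditional form of the
  hypothesis on B allows B = 0 when n - l is far from n \<open>\<theta>\<close>, and B = 1
  otherwise.\<close>

lemma ckn_upper:
  assumes n: "n \<ge> 2" "l \<le> n" and B: "B \<ge> 0" "\<bar>real (n - l) - real n * \<theta>\<bar> \<le> letter_dev \<Longrightarrow> 1 \<le> B"
  shows "real (ckn TYPE('a::field) m w l n) \<le> real (n * card (letter_words (n - 1))) * B"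
proof -
  obtain N where N: "n = Suc N" "N > 0" using n by (cases n) auto
  let ?V = "gr_vars l n"
  let ?T = "\<lambda>v. range Inr \<inter> (?V - {v})"
  have "real (ckn TYPE('a) m w l n) \<le> real (card ?V * card (letter_words N)) * B"
    unfolding ckn_def
  proof (rule codim_le_letter_words[where Sel = "\<lambda>v u. if card (?T v) = length (filter id u) then {?T v} else {}"])
    show "card ?V = Suc N" using card_gr_vars n N by simp
    fix v u assume v: "v \<in> ?V" and u: "u \<in> letter_words N"
    have "1 \<le> B" if c: "card (?T v) = length (filter id u)"
    proof (rule B(2), rule letter_count_shift[OF c u N(1)])
      \<comment> \<open>The first variable v may be odd, so this set has n - l or n - l - 1
        elements.\<close>
      have "?T v = Inr ` {..<n - l} - {v}" by auto
      then have "card (?T v) = card (Inr ` {..<n - l} :: (nat + nat) set) - (if v \<in> Inr ` {..<n - l} then 1 else 0)"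
        by (simp add: card_Diff_singleton_if)
      moreover have "card (Inr ` {..<n - l} :: (nat + nat) set) = n - l" by (simp add: card_image)
      ultimately show "\<bar>real (n - l) - real (card (?T v))\<bar> \<le> 1" by (auto simp: of_nat_diff)
    qed
    then show "(if card (?T v) = length (filter id u) then {?T v} else {}) \<subseteq> Pow (?V - {v})
        \<and> real (card (if card (?T v) = length (filter id u) then {?T v} else {})) \<le> B"
      using B(1) by auto
  next
    fix \<sigma> :: "nat + nat \<Rightarrow> gen \<Rightarrow> 'a" and v u S
    assume \<sigma>: "\<sigma> \<in> gr_substs" and v: "v \<in> ?V" and S: "S \<subseteq> ?V - {v}" "card S = length (filter id u)"
      and out: "S \<notin> (if card (?T v) = length (filter id u) then {?T v} else {})"
    have "S \<noteq> ?T v" using S(2) out by (auto split: if_splits)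
    then obtain x where x': "x \<in> S \<longleftrightarrow> x \<notin> ?T v" by blast
    then have x: "x \<in> ?V - {v}" "x \<in> S \<longleftrightarrow> x \<notin> range Inr" using S(1) by blast+
    have ev: "\<sigma> (Inl i) GB = 0" and od: "\<sigma> (Inr i) GA = 0" for i
    proof -
      have "\<sigma> (Inl i) \<in> alg_even K" "\<sigma> (Inr i) \<in> alg_odd K" using \<sigma> by auto
      then show "\<sigma> (Inl i) GB = 0" "\<sigma> (Inr i) GA = 0"
        by (auto simp: alg_even_def alg_odd_def supp_def)
    qed
    have "\<sigma> x (letter_gen (x \<in> S)) = 0" using x(2) ev od by (cases x) (auto simp: letter_gen_def)
    then show "\<exists>x\<in>?V - {v}. \<sigma> x (letter_gen (x \<in> S)) = 0" using x(1) by blast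
  next
    fix \<sigma> :: "nat + nat \<Rightarrow> gen \<Rightarrow> 'a" and v
    assume "\<sigma> \<in> gr_substs"
    then show "\<sigma> v \<in> alg_carrier K" by (cases v) (auto simp: alg_even_def alg_odd_def)
  qed (use N in auto)
  then show ?thesis using card_gr_vars n N by simp
qed

text \<open>A summand with n - l far from n \<open>\<theta>\<close> is 0. In the others the
  codimension is polynomially bounded, and the weight n choose l = n choose (n - l) is one of the
  binomials bounded by B.\<close>

lemma cn_gr_upper:
  assumes n: "n \<ge> 2" and B: "\<And>d. d \<le> n \<Longrightarrow> \<bar>real d - real n * \<theta>\<bar> \<le> letter_dev \<Longrightarrow> real (n choose d) \<le> B" "B \<ge> 0"
  shows "real (cn_gr TYPE('a::field) m w n) \<le> real (m + 1) * (real n + (real C + 1)) ^ 3 * B"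
proof -
  obtain N where N: "n = Suc N" "N > 0" using n by (cases n) auto
  have "real ((n choose l) * ckn TYPE('a) m w l n) \<le> real (n * card (letter_words N)) * B" if l: "l \<le> n" for l
  proof (cases "\<bar>real (n - l) - real n * \<theta>\<bar> \<le> letter_dev")
    case True
    have "real (ckn TYPE('a) m w l n) \<le> real (n * card (letter_words N)) * 1"
      using ckn_upper[OF n l, of 1] N by simp
    moreover have "real (n choose l) \<le> B"
      using B(1)[OF _ True] l by (simp add: binomial_symmetric[OF l, symmetric])
    ultimately show ?thesis
      using mult_mono[of "real (ckn TYPE('a) m w l n)" "real (n * card (letter_words N))" "real (n choose l)" B]
      by (simp add: mult.commute)
  next
    case False
    then have "real (ckn TYPE('a) m w l n) \<le> 0" using ckn_upper[OF n l, of 0] by simp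
    then show ?thesis using B(2) by simp
  qed
  then have "real (cn_gr TYPE('a) m w n) \<le> (\<Sum>l\<le>n. real (n * card (letter_words N)) * B)"
    unfolding cn_gr_def of_nat_sum by (intro sum_mono) simp
  also have "\<dots> = real (Suc n) * (real (n * card (letter_words N)) * B)" by simp
  also have "\<dots> \<le> real (m + 1) * (real n + (real C + 1)) ^ 3 * B" by (rule poly_bound[OF N(1) B(2)])
  finally show ?thesis .
qed

lemma path_subst_graded: "path_subst (Inl 0) (range Inr) \<in> gr_substs"
proof -
  have "delta (zpos K 0) \<in> alg_even K" "delta GA \<in> alg_even K" "delta GB \<in> alg_odd K"
    using delta_in_carrier[OF zpos_in_basis, of 0] delta_in_carrier[of GA] delta_in_carrier[of GB]
    by (auto simp: alg_even_def alg_odd_def basis_set_eq supp_def delta_def zpos_def)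
  then show ?thesis by (auto simp: path_subst_def letter_gen_def)
qed

text \<open>A single summand suffices: with as many odd variables as the prefix has letters b, the
  walk from z_1^(1) is a graded substitution and the codimension is at least 1. The binomial
  coefficient is the weight of this summand.\<close>

lemma cn_gr_lower:
  assumes "n \<ge> 2"
  shows "(n - 1) choose prefix_count n \<le> cn_gr TYPE('a::field) m w n"
proof -
  have q: "prefix_count n \<le> n - 1" by (rule prefix_count_le)
  define l where "l = n - prefix_count n"
  have l: "l \<le> n" "n - l = prefix_count n" "0 < l" using q assms by (auto simp: l_def)
  let ?V = "gr_vars l n"
  have T: "range Inr \<inter> (?V - {Inl 0}) = Inr ` {..<prefix_count n}" using l by auto
  have "card {Inr ` {..<prefix_count n} :: (nat + nat) set} \<le> ckn TYPE('a) m w l n"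
    unfolding ckn_def
  proof (rule codim_ge_path_subst[where N = "n - 1" and v = "Inl 0"])
    fix S :: "(nat + nat) set" assume S: "S \<in> {Inr ` {..<prefix_count n}}"
    show "S \<subseteq> ?V - {Inl 0} \<and> card S = length (filter id (letters 0 (n - 1)))"
      using S l by (auto simp: card_image prefix_count_def)
    show "\<exists>T. T \<inter> (?V - {Inl 0}) = S \<and> path_subst (Inl 0) T \<in> gr_substs"
      using S T path_subst_graded by blast
  qed (use l assms card_gr_vars[of l n] in auto)
  then have "1 \<le> ckn TYPE('a) m w l n" by simp
  have "(n - 1) choose prefix_count n \<le> n choose prefix_count n"
    using choose_mono_Suc[of "n - 1" "prefix_count n"] assms by simp
  also have "\<dots> = n choose l" unfolding l(2)[symmetric] by (rule binomial_symmetric[OF l(1), symmetric])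
  also have "\<dots> \<le> (n choose l) * ckn TYPE('a) m w l n" using \<open>1 \<le> ckn TYPE('a) m w l n\<close> by simp
  also have "\<dots> \<le> cn_gr TYPE('a) m w n"
    unfolding cn_gr_def using l(1) by (intro member_le_sum) auto
  finally show ?thesis .
qed

lemma exponents:
  "(\<lambda>n. root n (real (cn_gr TYPE('a::field) m w n))) \<longlonglongrightarrow> Phi \<theta>"
  "(\<lambda>n. root n (real (cn TYPE('a::field) m w n))) \<longlonglongrightarrow> Phi \<theta>"
  by (rule root_limit[OF \<theta>_bounds prefix_count_dev cn_gr_lower cn_gr_upper]; simp)
    (rule root_limit[OF \<theta>_bounds prefix_count_dev cn_lower cn_upper]; simp)

end

theorem theorem3:
  fixes m :: nat and w :: "nat \<Rightarrow> nat" and \<alpha> :: real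
  assumes "m \<ge> 2"
    and "binary_word w"
    and "periodic_word w \<or> sturmian w"
    and "has_slope w \<alpha>"
  shows "(\<lambda>n. root n (real (cn_gr TYPE('a::field_char_0) m w n)))
            \<longlonglongrightarrow> Phi (1 / (real m + \<alpha>))
       \<and> (\<lambda>n. root n (real (cn TYPE('a::field_char_0) m w n)))
            \<longlonglongrightarrow> Phi (1 / (real m + \<alpha>))"
proof -
  obtain C where "\<And>i j n. wsum w i n \<le> wsum w j n + C" "\<And>n. complexity w n \<le> n + C"
    using periodic_or_sturmian_balanced[OF assms(2,3)] by metis
  then interpret balanced_word_algebra m w \<alpha> C
    using assms by unfold_locales
  show ?thesis using exponents unfolding \<theta>_def by blast
qed

end
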